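(* Let $T\ge 0$ and let $\mathbf p_T=(\boldsymbol\lambda_T,\boldsymbol\eta_T)\in\mathbb R^n\times\mathbb R^n=\mathbb R^{2n}$ be nonzero. Put $\boldsymbol\xi_T=\boldsymbol\eta_T-\boldsymbol\lambda_T$, $\boldsymbol\eta(t)=\boldsymbol\lambda_T+\boldsymbol\xi_T e^{t-T}$, and let $\boldsymbol u_E(t)=\boldsymbol\eta(t)/\lVert\boldsymbol\eta(t)\rVert$ for almost every $t\in[0,T]$. Let $\boldsymbol r_E(t;T,\mathbf p_T)$ and $\boldsymbol v_E(t;T,\mathbf p_T)$ be the position and velocity at time $t$ of the isotropic rocket under the control $\boldsymbol u_E$. When $\boldsymbol\lambda_T\ne\boldsymbol 0$ put $\theta=T+\ln\frac{\lVert\boldsymbol\lambda_T\rVert}{\lVert\boldsymbol\lambda_T\rVert+\lVert\boldsymbol\eta_T\rVert}$. Then for all $t\in[0,T]$: (1) If $\lVert\boldsymbol\lambda_T\rVert\lVert\boldsymbol\eta_T\rVert>|(\boldsymbol\lambda_T,\boldsymbol\eta_T)|$, then, with $$L(t)=\ln\frac{\lVert\boldsymbol\xi_T\rVert\lVert\boldsymbol\eta(t)\rVert+(\boldsymbol\xi_T,\boldsymbol\eta(t))}{\lVert\boldsymbol\xi_T\rVert\lVert\boldsymbol\eta(0)\rVert+(\boldsymbol\xi_T,\boldsymbol\eta(0))},$$ $$\boldsymbol v_E(t;T,\mathbf p_T)=\boldsymbol v_0e^{-t}+\frac{\lVert\boldsymbol\eta(t)\rVert-\lVert\boldsymbol\eta(0)\rVert}{\lVert\boldsymbol\xi_T\rVert^2}e^{T-t}\boldsymbol\xi_T+\left(\frac{\boldsymbol\lambda_T}{\lVert\boldsymbol\xi_T\rVert}-\frac{(\boldsymbol\lambda_T,\boldsymbol\xi_T)}{\lVert\boldsymbol\xi_T\rVert^3}\boldsymbol\xi_T\right)e^{T-t}L(t),$$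 $$\boldsymbol r_E(t;T,\mathbf p_T)=\boldsymbol v_0-\boldsymbol v_E(t;T,\mathbf p_T)+\frac{\boldsymbol\lambda_T}{\lVert\boldsymbol\lambda_T\rVert}\left(t+\ln\frac{\lVert\boldsymbol\lambda_T\rVert\lVert\boldsymbol\eta(0)\rVert+(\boldsymbol\lambda_T,\boldsymbol\eta(0))}{\lVert\boldsymbol\lambda_T\rVert\lVert\boldsymbol\eta(t)\rVert+(\boldsymbol\lambda_T,\boldsymbol\eta(t))}\right)+\frac{\boldsymbol\xi_T}{\lVert\boldsymbol\xi_T\rVert}L(t).$$ (2) If $\lVert\boldsymbol\lambda_T\rVert\lVert\boldsymbol\eta_T\rVert=-(\boldsymbol\lambda_T,\boldsymbol\eta_T)$ and $\boldsymbol\lambda_T\ne\boldsymbol0$, then $$\boldsymbol v_E(t;T,\mathbf p_T)=\boldsymbol v_0e^{-t}+\frac{\boldsymbol\lambda_T}{\lVert\boldsymbol\lambda_T\rVert}\left(\left|e^{-t}-e^{\theta-t}\right|-\left|1-e^{\theta-t}\right|\right),$$ $$\boldsymbol r_E(t;T,\mathbf p_T)=\boldsymbol v_0-\boldsymbol v_E(t;T,\mathbf p_T)+\frac{\boldsymbol\lambda_T}{\lVert\boldsymbol\lambda_T\rVert}\left(|\theta|-|t-\theta|\right).$$ (3) If $\lVert\boldsymbol\lambda_T\rVert\lVert\boldsymbol\eta_T\rVert=(\boldsymbol\lambda_T,\boldsymbol\eta_T)$ and $\boldsymbol\lambda_T\ne\boldsymbol0$, then $$\boldsymbol v_E(t;T,\mathbf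 p_T)=\boldsymbol v_0e^{-t}+\frac{\boldsymbol\lambda_T}{\lVert\boldsymbol\lambda_T\rVert}(1-e^{-t}),\qquad \boldsymbol r_E(t;T,\mathbf p_T)=\boldsymbol v_0-\boldsymbol v_E(t;T,\mathbf p_T)+\frac{\boldsymbol\lambda_T}{\lVert\boldsymbol\lambda_T\rVert}t.$$ (4) If $\boldsymbol\lambda_T=\boldsymbol0$, then $$\boldsymbol v_E(t;T,\mathbf p_T)=\boldsymbol v_0e^{-t}+\frac{\boldsymbol\eta_T}{\lVert\boldsymbol\eta_T\rVert}(1-e^{-t}),\qquad \boldsymbol r_E(t;T,\mathbf p_T)=\boldsymbol v_0-\boldsymbol v_E(t;T,\mathbf p_T)+\frac{\boldsymbol\eta_T}{\lVert\boldsymbol\eta_T\rVert}t.$$ Moreover, for every $T\ge0$ the boundary of the reachable set is $$\partial\mathcal R(T)=\left\{\left(\boldsymbol r_E(T;T,\mathbf p_T),\boldsymbol v_E(T;T,\mathbf p_T)\right):\ \mathbf p_T\in\mathbb R^{2n},\ \lVert\mathbf p_T\rVert=1\right\}.$$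
   Context: Let $n\in\mathbb N$, $n\ge1$; $(\cdot,\cdot)$ and $\lVert\cdot\rVert$ are the Euclidean inner product and norm. Fix $v_0\in[0,1)$ and $\boldsymbol v_0=(v_0,0,\dots,0)\in\mathbb R^n$. The set of admissible controls $\mathcal A$ consists of measurable functions $\boldsymbol u$ of time $t\ge0$ with values in the closed unit ball $\{\mathbf u\in\mathbb R^n:\lVert\mathbf u\rVert\le1\}$. For $\boldsymbol u\in\mathcal A$, the isotropic rocket's position $\boldsymbol r(\cdot;\boldsymbol u)$ and velocity $\boldsymbol v(\cdot;\boldsymbol u)$ are the absolutely continuous solutions of $\dot{\boldsymbol r}=\boldsymbol v$, $\dot{\boldsymbol v}=\boldsymbol u-\boldsymbol v$ (a.e.) with $\boldsymbol r(0;\boldsymbol u)=\boldsymbol 0$, $\boldsymbol v(0;\boldsymbol u)=\boldsymbol v_0$. The reachable set at time $t$ is $\mathcal R(t)=\{(\boldsymbol r(t;\boldsymbol u),\boldsymbol v(t;\boldsymbol u)):\boldsymbol u\in\mathcal A\}\subset\mathbb R^{2n}$, and $\partial\mathcal R(t)$ is its topological boundary in $\mathbb R^{2n}$. (For nonzero $\mathbf p_T$ the function $\boldsymbol\eta$ vanishes for at most one $t$, so $\boldsymbol u_E$ is defined almost everywhere on $[0,T]$; its values elsewhere are immaterial.) *)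

theory Defs
  imports "HOL-Analysis.Analysis"
begin

text \<open>Absolute continuity on a compact interval, in the usual epsilon-delta form over finite
  families of non-overlapping closed subintervals: a division of its own union is exactly such a
  family.  (The constant \<^const>\<open>absolutely_continuous\<close> concerns measures, not functions.)\<close>

definition abs_continuous_fun :: "real \<Rightarrow> real \<Rightarrow> (real \<Rightarrow> 'a::real_normed_vector) \<Rightarrow> bool" where
  "abs_continuous_fun a b f \<longleftrightarrow>
     (\<forall>\<epsilon>>0. \<exists>\<delta>>0. \<forall>D. D division_of \<Union>D \<longrightarrow> \<Union>D \<subseteq> {a..b} \<longrightarrow> (\<Sum>K\<in>D. Sup K - Inf K) < \<delta>
        \<longrightarrow> (\<Sum>K\<in>D. norm (f (Sup K) - f (Inf K))) < \<epsilon>)"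

text \<open>Controls and trajectories are functions on the whole real line of which only the values on
  \<open>{0..}\<close> matter; measurability is in the sense of Lebesgue.\<close>

definition admissible_controls :: "(real \<Rightarrow> real^'n) set" where
  "admissible_controls = {u. u \<in> borel_measurable (lebesgue_on {0..}) \<and> (\<forall>t\<ge>0. norm (u t) \<le> 1)}"

text \<open>The index \<open>k\<close> designates the first coordinate of \<open>real^'n\<close>, so that \<open>axis k v0\<close> is the
  initial velocity \<open>(v0, 0, \<dots>, 0)\<close>; the finite index type carries no order of its own.\<close>

definition rocket_solution ::
    "'n \<Rightarrow> real \<Rightarrow> (real \<Rightarrow> real^'n) \<Rightarrow> (real \<Rightarrow> real^'n) \<Rightarrow> (real \<Rightarrow> real^'n) \<Rightarrow> bool" where
  "rocket_solution k v0 u r v \<longleftrightarrow>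
     (\<forall>T\<ge>0. abs_continuous_fun 0 T r \<and> abs_continuous_fun 0 T v) \<and>
     r 0 = 0 \<and> v 0 = axis k v0 \<and>
     (AE t in lebesgue_on {0..}.
        (r has_vector_derivative v t) (at t within {0..}) \<and>
        (v has_vector_derivative (u t - v t)) (at t within {0..}))"

definition rocket_pos :: "'n \<Rightarrow> real \<Rightarrow> (real \<Rightarrow> real^'n) \<Rightarrow> real \<Rightarrow> real^'n" where
  "rocket_pos k v0 u t = (THE x. \<exists>r v. rocket_solution k v0 u r v \<and> r t = x)"

definition rocket_vel :: "'n \<Rightarrow> real \<Rightarrow> (real \<Rightarrow> real^'n) \<Rightarrow> real \<Rightarrow> real^'n" where
  "rocket_vel k v0 u t = (THE x. \<exists>r v. rocket_solution k v0 u r v \<and> v t = x)"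

definition reachable_set :: "'n \<Rightarrow> real \<Rightarrow> real \<Rightarrow> ((real^'n) \<times> (real^'n)) set" where
  "reachable_set k v0 t = {(rocket_pos k v0 u t, rocket_vel k v0 u t) | u. u \<in> admissible_controls}"

definition costate :: "real \<Rightarrow> real^'n \<Rightarrow> real^'n \<Rightarrow> real \<Rightarrow> real^'n" where
  "costate T lam\<^sub>T eta\<^sub>T t = lam\<^sub>T + exp (t - T) *\<^sub>R (eta\<^sub>T - lam\<^sub>T)"

text \<open>An extremal control is prescribed only almost everywhere on \<open>{0..T}\<close>; elsewhere it is an
  arbitrary admissible control.\<close>

definition extremal_control :: "real \<Rightarrow> (real^'n) \<times> (real^'n) \<Rightarrow> (real \<Rightarrow> real^'n) \<Rightarrow> bool" where
  "extremal_control T p u \<longleftrightarrow> u \<in> admissible_controls \<and>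
     (AE t in lebesgue_on {0..T}.
        u t = costate T (fst p) (snd p) t /\<^sub>R norm (costate T (fst p) (snd p) t))"

end

theory Submission
  imports Defs
begin

text \<open>
Both the closed formulas and the description of the boundary rest on the fact that a control acts
only through two integrals: multiplying \<open>v' = u - v\<close> by \<open>e\<^sup>t\<close> and adding \<open>r' = v\<close> give
\<open>v(t) = e\<^sup>-\<^sup>t (v\<^sub>0 + J(t))\<close> and \<open>r(t) = v\<^sub>0 - v(t) + I(t)\<close>, where \<open>I\<close> and \<open>J\<close> are the integrals over
\<open>[0, t]\<close> of \<open>u(s)\<close> and \<open>e\<^sup>s u(s)\<close>. Making this rigorous for merely measurable controls takes two facts
of real analysis: an absolutely continuous function is the integral of its almost everywhere
derivative (\<open>abs_continuous_imp_has_integral\<close>), which yields uniqueness of trajectories, and an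
indefinite integral is almost everywhere differentiable
(\<open>indefinite_integral_has_derivative_except_negligible\<close>), which yields existence.

For an extremal control the integrands are \<open>\<eta>(s) / |\<eta>(s)|\<close> and \<open>e\<^sup>s \<eta>(s) / |\<eta>(s)|\<close> with \<open>\<eta>(s)\<close> affine in
\<open>e\<^sup>s\<close>. In the degenerate cases \<open>\<eta>\<close> stays on one line and changes sign at most once, at \<open>\<theta>\<close>; otherwise
\<open>\<lambda>\<^sub>T\<close> and \<open>\<xi>\<^sub>T\<close> are linearly independent, \<open>\<eta>\<close> never vanishes, and differentiating logarithms of
\<open>|\<xi>\<^sub>T| |\<eta>| + (\<xi>\<^sub>T, \<eta>)\<close> and \<open>|\<lambda>\<^sub>T| |\<eta>| + (\<lambda>\<^sub>T, \<eta>)\<close> produces exactly the coefficients of \<open>\<xi>\<^sub>T\<close> and \<open>\<lambda>\<^sub>T\<close>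
in \<open>\<eta> / |\<eta>|\<close> (\<open>costate_primitives\<close>).

For the boundary, fix \<open>p \<noteq> 0\<close>. Up to a constant, the value of the linear functional \<open>p\<close> at the endpoint
reached with \<open>u\<close> is the integral of \<open>(\<eta>(s), u(s))\<close> over \<open>[0, T]\<close> (\<open>inner_endpoint\<close>). It is maximal
precisely when \<open>u\<close> points along \<open>\<eta>\<close> almost everywhere, so extremal endpoints maximise a nonzero
functional on the reachable set and cannot be interior. Conversely the reachable set is convex, so a
boundary point \<open>z\<close> maximises some functional \<open>p\<close> over the closure. The point \<open>z\<close> is a limit of
endpoints whose controls \<open>u\<^sub>n\<close> have payoff tending to the maximum. Since the maximiser is strict at
almost every time, a subsequence of \<open>u\<^sub>n\<close> converges almost everywhere to the extremal control
(\<open>maximising_sequence_converges\<close>), and dominated convergence identifies \<open>z\<close> with its endpoint. Hence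
every boundary point is attained, and the closedness of the reachable set comes out of the argument.
\<close>

section \<open>Absolutely continuous functions as integrals of their derivatives\<close>

text \<open>A gauge argument. Intervals tagged outside \<open>N\<close> are controlled by the derivative at the tag. The intervals tagged in \<open>N\<close> are forced by the gauge into an open
set of measure below the \<open>\<delta>\<close> of absolute continuity, so the increments of \<open>f\<close> over them are
negligible too.\<close>

lemma abs_continuous_imp_has_integral:
  fixes f :: "real \<Rightarrow> 'a::banach"
  assumes ab: "a \<le> b" and ac: "abs_continuous_fun a b f" and N: "negligible N"
    and der: "\<And>x. x \<in> {a..b} - N \<Longrightarrow> (f has_vector_derivative f' x) (at x within {a..b})"
  shows "(f' has_integral (f b - f a)) {a..b}"
proof -
  define g where "g x = (if x \<in> N then 0 else f' x)" for x
  have "(g has_integral (f b - f a)) {a..b}"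
    unfolding has_integral_real
  proof (intro allI impI)
    fix e :: real assume e: "e > 0"
    define e' where "e' = e / (2 * (b - a + 1))"
    have e': "e' > 0" using e ab by (simp add: e'_def)
    have "e / 2 > 0" using e by simp
    then obtain \<delta> where \<delta>: "\<delta> > 0"
      and small: "\<And>D. D division_of \<Union>D \<Longrightarrow> \<Union>D \<subseteq> {a..b} \<Longrightarrow> (\<Sum>K\<in>D. Sup K - Inf K) < \<delta>
        \<Longrightarrow> (\<Sum>K\<in>D. norm (f (Sup K) - f (Inf K))) < e / 2"
      using ac unfolding abs_continuous_fun_def by meson
    obtain G where G: "open G" "N \<subseteq> G" "G - N \<in> lmeasurable" "emeasure lebesgue (G - N) < ennreal \<delta>"
      using sets_lebesgue_outer_open[of N \<delta>] N \<delta> negligible_imp_sets by blast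
    have Gm: "G \<in> lmeasurable"
      using fmeasurable.Un[OF G(3) negligible_imp_measurable[OF N]] G(2)
      by (simp add: Un_absorb2)
    have "measure lebesgue G = measure lebesgue (G - N)"
      by (rule measure_negligible_symdiff[OF G(3)])
         (rule negligible_subset[OF N], auto)
    also have "\<dots> < \<delta>"
      using G(3,4) \<delta> by (simp add: emeasure_eq_measure2 ennreal_less_iff)
    finally have Gs: "measure lebesgue G < \<delta>" .
    have "\<exists>d>0. (x \<in> N \<longrightarrow> ball x d \<subseteq> G) \<and>
        (x \<in> {a..b} - N \<longrightarrow> (\<forall>y\<in>{a..b}. norm (y - x) < d \<longrightarrow>
           norm (f y - f x - (y - x) *\<^sub>R f' x) \<le> e' * norm (y - x)))" for x
    proof (cases "x \<in> N")
      case True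
      then show ?thesis using G(1,2) by (metis DiffD2 openE subsetD)
    next
      case False
      show ?thesis
      proof (cases "x \<in> {a..b}")
        case True
        with False der have "(f has_vector_derivative f' x) (at x within {a..b})" by blast
        then show ?thesis
          using False e' unfolding has_vector_derivative_def has_derivative_within_alt by blast
      next
        case F: False
        then show ?thesis using False by (intro exI[of _ 1]) auto
      qed
    qed
    then obtain d where d0: "\<And>x. d x > 0"
      and dN: "\<And>x. x \<in> N \<Longrightarrow> ball x (d x) \<subseteq> G"
      and dD: "\<And>x y. x \<in> {a..b} \<Longrightarrow> x \<notin> N \<Longrightarrow> y \<in> {a..b} \<Longrightarrow> norm (y - x) < d x \<Longrightarrow>
           norm (f y - f x - (y - x) *\<^sub>R f' x) \<le> e' * norm (y - x)"
      by (metis DiffI)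
    show "\<exists>\<gamma>. gauge \<gamma> \<and> (\<forall>p. p tagged_division_of {a..b} \<and> \<gamma> fine p \<longrightarrow>
          norm ((\<Sum>(x, K)\<in>p. measure lborel K *\<^sub>R g x) - (f b - f a)) < e)"
    proof (intro exI conjI allI impI; (elim conjE)?)
      show "gauge (\<lambda>x. ball x (d x))" using d0 by (simp add: gauge_ball_dependent)
    next
      fix p assume p: "p tagged_division_of {a..b}" and fine: "(\<lambda>x. ball x (d x)) fine p"
      have fin: "finite p" using p by blast
      have shape: "\<exists>u v. K = {u..v} \<and> u \<le> v \<and> u \<in> {a..b} \<and> v \<in> {a..b} \<and> x \<in> {u..v} \<and> {u..v} \<subseteq> ball x (d x)
          \<and> measure lborel K = v - u \<and> Sup K = v \<and> Inf K = u"
        if xK: "(x, K) \<in> p" for x K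
      proof -
        obtain u v where uv: "K = cbox u v" using tagged_division_ofD(4)[OF p xK] by blast
        have 1: "x \<in> K" "K \<subseteq> {a..b}"
          using tagged_division_ofD(2)[OF p xK] tagged_division_ofD(3)[OF p xK] by auto
        have 2: "K \<subseteq> ball x (d x)" by (rule fineD[OF fine xK])
        have le: "u \<le> v" using 1 uv by simp
        have 3: "u \<in> {a..b}" "v \<in> {a..b}" using 1 uv le by (auto simp: subset_iff)
        show ?thesis
          using uv 1 2 3 le by (intro exI[of _ u] exI[of _ v]) simp
      qed
      define \<Delta> where "\<Delta> K = f (Sup K) - f (Inf K)" for K
      define pN where "pN = {(x, K) \<in> p. x \<in> N}"
      have split: "p = pN \<union> (p - pN)" "pN \<subseteq> p" by (auto simp: pN_def)
      have "(\<Sum>(x, K)\<in>p. measure lborel K *\<^sub>R g x) - (f b - f a) = (\<Sum>(x, K)\<in>p. measure lborel K *\<^sub>R g x - \<Delta> K)"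
        using additive_tagged_division_1[OF ab p, of f]
        by (simp add: sum_subtractf split_def \<Delta>_def)
      also have "norm \<dots> \<le> (\<Sum>(x, K)\<in>p. norm (measure lborel K *\<^sub>R g x - \<Delta> K))"
        by (rule order_trans[OF norm_sum]) (simp add: split_def)
      also have "\<dots> = (\<Sum>(x, K)\<in>pN. norm (measure lborel K *\<^sub>R g x - \<Delta> K))
            + (\<Sum>(x, K)\<in>p - pN. norm (measure lborel K *\<^sub>R g x - \<Delta> K))"
        using fin split by (subst sum.subset_diff[of pN p]) auto
      also have "\<dots> < e / 2 + e / 2"
      proof (rule add_less_le_mono)
        have pd: "pN tagged_division_of \<Union>(snd ` pN)"
          using p tagged_partial_division_of_Union_self[OF tagged_partial_division_subset[OF _ split(2)]]
          unfolding tagged_division_of_def by blast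
        have dv: "snd ` pN division_of \<Union>(snd ` pN)"
          using division_of_tagged_division[OF pd] .
        \<comment> \<open>Distinct tags may share an interval only if it is degenerate; such an interval contributes \<open>0\<close>,
          and the empty set is given the value \<open>0\<close> because \<open>Sup {}\<close> and \<open>Inf {}\<close> are unspecified.\<close>
        have eq: "(\<Sum>(x, K)\<in>pN. norm (measure lborel K *\<^sub>R g x - \<Delta> K)) = (\<Sum>K\<in>snd ` pN. norm (\<Delta> K))"
        proof -
          have "(\<Sum>(x, K)\<in>pN. norm (measure lborel K *\<^sub>R g x - \<Delta> K)) = (\<Sum>(x, K)\<in>pN. norm (\<Delta> K))"
            by (rule sum.cong) (auto simp: pN_def g_def)
          also have "\<dots> = (\<Sum>(x, K)\<in>pN. if K = {} then 0 else norm (\<Delta> K))"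
            using tagged_division_ofD(2)[OF pd] by (intro sum.cong) fastforce+
          also have "\<dots> = (\<Sum>K\<in>snd ` pN. if K = {} then 0 else norm (\<Delta> K))"
            by (rule sum.over_tagged_division_lemma[OF pd]) (auto simp: \<Delta>_def)
          also have "\<dots> = (\<Sum>K\<in>snd ` pN. norm (\<Delta> K))"
            using tagged_division_ofD(2)[OF pd] by (intro sum.cong) fastforce+
          finally show ?thesis .
        qed
        have sub: "\<Union>(snd ` pN) \<subseteq> {a..b}"
          using split(2) tagged_division_ofD(3)[OF p] by force
        have "(\<Sum>K\<in>snd ` pN. Sup K - Inf K) = (\<Sum>K\<in>snd ` pN. measure lebesgue K)"
        proof (rule sum.cong[OF refl])
          fix K assume "K \<in> snd ` pN"
          then obtain x where "(x, K) \<in> p" by (auto simp: pN_def)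
          from shape[OF this] show "Sup K - Inf K = measure lebesgue K" by force
        qed
        also have "\<dots> = measure lebesgue (\<Union>(snd ` pN))"
          using content_division[OF dv] by simp
        also have "\<dots> \<le> measure lebesgue G"
        proof (rule measure_mono_fmeasurable)
          show "\<Union>(snd ` pN) \<subseteq> G"
          proof
            fix s assume "s \<in> \<Union>(snd ` pN)"
            then obtain x K where "s \<in> K" "(x, K) \<in> pN" by auto
            then have "(x, K) \<in> p" "x \<in> N" "s \<in> K" by (auto simp: pN_def)
            with shape[of x K] dN[of x] show "s \<in> G" by blast
          qed
          show "\<Union>(snd ` pN) \<in> sets lebesgue"
            using lmeasurable_division[OF dv] by blast
        qed (rule Gm)
        finally have "(\<Sum>K\<in>snd ` pN. Sup K - Inf K) < \<delta>" using Gs by linarith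
        from small[OF dv sub this]
        show "(\<Sum>(x, K)\<in>pN. norm (measure lborel K *\<^sub>R g x - \<Delta> K)) < e / 2"
          using eq unfolding \<Delta>_def by simp
      next
        have "(\<Sum>(x, K)\<in>p - pN. norm (measure lborel K *\<^sub>R g x - \<Delta> K)) \<le> (\<Sum>(x, K)\<in>p - pN. e' * measure lborel K)"
        proof (rule sum_mono, unfold split_paired_all prod.case)
          fix x K assume "(x, K) \<in> p - pN"
          then have xK: "(x, K) \<in> p" "(x, K) \<notin> pN" by auto
          then have xN: "x \<notin> N" by (auto simp: pN_def)
          obtain u v where uv: "K = {u..v}" "u \<le> v" "u \<in> {a..b}" "v \<in> {a..b}" "x \<in> {u..v}"
            "{u..v} \<subseteq> ball x (d x)" "measure lborel K = v - u" "Sup K = v" "Inf K = u"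
            using shape[OF xK(1)] by blast
          have "x \<in> {a..b}" using uv by auto
          moreover have "norm (u - x) < d x" "norm (v - x) < d x"
            using uv(2) subsetD[OF uv(6), of u] subsetD[OF uv(6), of v]
            by (simp_all add: dist_real_def abs_minus_commute)
          ultimately have 1: "norm (f u - f x - (u - x) *\<^sub>R f' x) \<le> e' * norm (u - x)"
            "norm (f v - f x - (v - x) *\<^sub>R f' x) \<le> e' * norm (v - x)"
            using dD xN uv(3,4) by blast+
          have "measure lborel K *\<^sub>R g x - \<Delta> K
            = (f u - f x - (u - x) *\<^sub>R f' x) - (f v - f x - (v - x) *\<^sub>R f' x)"
            using uv xN by (simp add: g_def \<Delta>_def algebra_simps)
          also have "norm \<dots> \<le> e' * norm (u - x) + e' * norm (v - x)"
            using 1 norm_triangle_ineq4 by (smt (verit))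
          also have "\<dots> = e' * measure lborel K"
            using uv by (simp add: algebra_simps)
          finally show "norm (measure lborel K *\<^sub>R g x - \<Delta> K) \<le> e' * measure lborel K" .
        qed
        also have "\<dots> \<le> (\<Sum>(x, K)\<in>p. e' * measure lborel K)"
          using e' fin by (intro sum_mono2) auto
        also have "\<dots> = e' * (b - a)"
          using additive_content_tagged_division[of p a b] p ab
          by (simp add: sum_distrib_left[symmetric] split_def)
        also have "\<dots> \<le> e / 2"
          using e ab by (simp add: e'_def field_simps)
        finally show "(\<Sum>(x, K)\<in>p - pN. norm (measure lborel K *\<^sub>R g x - \<Delta> K)) \<le> e / 2" .
      qed
      finally show "norm ((\<Sum>(x, K)\<in>p. measure lborel K *\<^sub>R g x) - (f b - f a)) < e" by simp
    qed
  qed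
  then show ?thesis
    by (rule has_integral_spike[OF N, rotated]) (auto simp: g_def)
qed

section \<open>Almost everywhere differentiability of indefinite integrals\<close>

text \<open>Lebesgue's differentiation theorem on the line, in gauge form. At a point \<open>x\<close> where the difference
quotients miss \<open>f x\<close> by more than \<open>c\<close> there are arbitrarily short intervals with an endpoint \<open>x\<close> on which
the integral differs from \<open>f x\<close> times the length by more than \<open>c\<close> times the length. A disjoint Vitali
subfamily covers almost all such \<open>x\<close>, and by Henstock's lemma its total length is as small as desired.\<close>

lemma indefinite_integral_has_derivative_except_negligible:
  fixes f :: "real \<Rightarrow> 'a::euclidean_space"
  assumes f: "f integrable_on {a..b}"
  obtains N where "negligible N"
    "\<And>x. x \<in> {a<..<b} - N \<Longrightarrow> ((\<lambda>t. integral {a..t} f) has_vector_derivative f x) (at x)"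
proof -
  define F where "F t = integral {a..t} f" for t
  have incr: "norm (integral {min x y..max x y} f - \<bar>y - x\<bar> *\<^sub>R f x) = norm (F y - F x - (y - x) *\<^sub>R f x)"
    if "x \<in> {a..b}" "y \<in> {a..b}" for x y
  proof (cases "x \<le> y")
    case True
    have "F x + integral {x..y} f = F y"
      unfolding F_def using that True
      by (intro Henstock_Kurzweil_Integration.integral_combine integrable_subinterval_real[OF f]) auto
    then have "integral {x..y} f = F y - F x" by (simp add: algebra_simps)
    then show ?thesis using True by simp
  next
    case False
    have "F y + integral {y..x} f = F x"
      unfolding F_def using that False
      by (intro Henstock_Kurzweil_Integration.integral_combine integrable_subinterval_real[OF f]) auto
    then have "integral {y..x} f = F x - F y" by (simp add: algebra_simps)
    then have "F y - F x - (y - x) *\<^sub>R f x = - (integral {min x y..max x y} f - \<bar>y - x\<bar> *\<^sub>R f x)"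
      using False by (simp add: algebra_simps)
    then show ?thesis by (metis norm_minus_cancel)
  qed
  define bad where "bad c x y \<longleftrightarrow> norm (F y - F x - (y - x) *\<^sub>R f x) > c * \<bar>y - x\<bar>" for c x y
  define E where "E c = {x \<in> {a<..<b}. \<forall>d>0. \<exists>y\<in>{a..b}. y \<noteq> x \<and> \<bar>y - x\<bar> < d \<and> bad c x y}" for c
  have negE: "negligible (E c)" if c: "c > 0" for c
    unfolding negligible_outer_le
  proof (intro allI impI)
    fix e :: real assume e: "e > 0"
    obtain \<gamma> where \<gamma>: "gauge \<gamma>"
      and hen: "\<And>p. p tagged_partial_division_of cbox a b \<Longrightarrow> \<gamma> fine p \<Longrightarrow>
           (\<Sum>(x, K)\<in>p. norm (measure lborel K *\<^sub>R f x - integral K f)) < c * e"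
      using Henstock_lemma[of f a b "c * e"] f c e by auto
    \<comment> \<open>The pair \<open>(x, y)\<close> stands for the bad interval between the bad point \<open>x\<close> and \<open>y\<close>; as \<open>y\<close> may lie
      on either side, the interval is written with \<open>min\<close> and \<open>max\<close>, and with centre and radius for Vitali's theorem.\<close>
    define I where "I = {(x, y). x \<in> E c \<and> y \<in> {a..b} \<and> y \<noteq> x \<and> bad c x y \<and> {min x y..max x y} \<subseteq> \<gamma> x}"
    define m where "m = (\<lambda>(x::real, y). (x + y) / 2)"
    define r where "r = (\<lambda>(x::real, y). \<bar>y - x\<bar> / 2)"
    have seg: "cball (m i) (r i) = {min (fst i) (snd i)..max (fst i) (snd i)}" for i
      by (cases i) (auto simp: m_def r_def cball_eq_atLeastAtMost min_def max_def field_simps)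
    have 1: "\<And>i. i \<in> I \<Longrightarrow> 0 < r i" by (auto simp: I_def r_def)
    have 2: "\<exists>i. i \<in> I \<and> x \<in> cball (m i) (r i) \<and> r i < d" if x: "x \<in> E c" and d: "0 < d" for x d
    proof -
      have "open (\<gamma> x)" "x \<in> \<gamma> x" using \<gamma> by (auto simp: gauge_def)
      then obtain d' where d': "d' > 0" "ball x d' \<subseteq> \<gamma> x" by (meson openE)
      then have "min d d' > 0" using d by simp
      then obtain y where y: "y \<in> {a..b}" "y \<noteq> x" "\<bar>y - x\<bar> < min d d'" "bad c x y"
        using x unfolding E_def by blast
      have "{min x y..max x y} \<subseteq> ball x d'"
        using y(3) by (auto simp: dist_real_def)
      then have "(x, y) \<in> I" using y x d' by (auto simp: I_def)
      moreover have "r (x, y) < d" using y d by (simp add: r_def)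
      ultimately show ?thesis by (intro exI[of _ "(x, y)"]) (auto simp: seg)
    qed
    obtain C where C: "countable C" "C \<subseteq> I"
      "pairwise (\<lambda>i j. disjnt (cball (m i) (r i)) (cball (m j) (r j))) C"
      "negligible (E c - (\<Union>i\<in>C. cball (m i) (r i)))"
      using Vitali_covering_theorem_cballs[of I r "E c" m] 1 2 by blast
    \<comment> \<open>Finite parts of the Vitali family, tagged by their bad points, are partial divisions to which
      Henstock's lemma applies.\<close>
    have bound: "measure lebesgue (\<Union>i\<in>C'. cball (m i) (r i)) \<le> e" if C': "C' \<subseteq> C" "finite C'" for C'
    proof -
      define h where "h i = (fst i, cball (m i) (r i))" for i
      have inI: "i \<in> I" if "i \<in> C'" for i using that C' C(2) by blast
      have inj: "inj_on h C'"
      proof (rule inj_onI)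
        fix i j assume ij: "i \<in> C'" "j \<in> C'" "h i = h j"
        then have "cball (m i) (r i) = cball (m j) (r j)" by (simp add: h_def)
        moreover have "cball (m i) (r i) \<noteq> {}" using 1[OF inI[OF ij(1)]] by simp
        ultimately have "\<not> disjnt (cball (m i) (r i)) (cball (m j) (r j))" by (simp add: disjnt_def)
        then show "i = j" using C(3) C'(1) ij unfolding pairwise_def by blast
      qed
      have tpd: "h ` C' tagged_partial_division_of cbox a b"
        unfolding tagged_partial_division_of_def
      proof (intro conjI allI impI)
        show "finite (h ` C')" using C' by simp
      next
        fix x K assume "(x, K) \<in> h ` C'"
        then obtain i where i: "i \<in> C'" "x = fst i" "K = cball (m i) (r i)" by (auto simp: h_def)
        show "x \<in> K" using i by (simp add: seg)
        show "K \<subseteq> cbox a b" using inI[OF i(1)] i by (auto simp: seg I_def E_def)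
        show "\<exists>a b. K = cbox a b" using i(3) seg[of i] by (metis box_real(2))
      next
        fix x1 K1 x2 K2
        assume as: "(x1, K1) \<in> h ` C' \<and> (x2, K2) \<in> h ` C' \<and> (x1, K1) \<noteq> (x2, K2)"
        then obtain i j where ij0: "i \<in> C'" "j \<in> C'" "h i = (x1, K1)" "h j = (x2, K2)"
          by (metis imageE)
        moreover have "i \<noteq> j" using as ij0 by metis
        ultimately have ij: "i \<in> C'" "j \<in> C'" "h i = (x1, K1)" "h j = (x2, K2)" "i \<noteq> j" by auto
        then have "disjnt (cball (m i) (r i)) (cball (m j) (r j))"
          using C(3) C'(1) unfolding pairwise_def by blast
        then have "K1 \<inter> K2 = {}" using ij by (auto simp: h_def disjnt_def)
        then show "interior K1 \<inter> interior K2 = {}"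
          by (metis interior_Int interior_empty)
      qed
      have fine: "\<gamma> fine h ` C'"
        using inI by (fastforce simp: fine_def h_def seg I_def)
      have "measure lebesgue (\<Union>i\<in>C'. cball (m i) (r i)) \<le> (\<Sum>i\<in>C'. measure lebesgue (cball (m i) (r i)))"
        by (rule measure_UNION_le) (use C' in auto)
      also have "\<dots> = (\<Sum>(x, K)\<in>h ` C'. measure lborel K)"
        by (subst sum.reindex[OF inj]) (auto simp: h_def)
      also have "\<dots> \<le> (\<Sum>(x, K)\<in>h ` C'. norm (measure lborel K *\<^sub>R f x - integral K f) / c)"
      proof (rule sum_mono, unfold split_paired_all prod.case)
        fix x K assume "(x, K) \<in> h ` C'"
        then obtain y where y: "(x, y) \<in> C'" "K = {min x y..max x y}" by (auto simp: h_def seg)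
        then have b: "bad c x y" "x \<in> {a..b}" "y \<in> {a..b}" using inI[OF y(1)] by (auto simp: I_def E_def)
        have ct: "measure lborel K = \<bar>y - x\<bar>" using y by (simp add: min_def max_def)
        have "c * \<bar>y - x\<bar> < norm (integral K f - \<bar>y - x\<bar> *\<^sub>R f x)"
          using b(1) incr[OF b(2,3)] unfolding bad_def y(2) by linarith
        then show "measure lborel K \<le> norm (measure lborel K *\<^sub>R f x - integral K f) / c"
          using c unfolding ct by (simp add: field_simps norm_minus_commute)
      qed
      also have "\<dots> = (\<Sum>(x, K)\<in>h ` C'. norm (measure lborel K *\<^sub>R f x - integral K f)) / c"
        by (simp add: sum_divide_distrib split_def)
      also have "\<dots> \<le> e"
        using hen[OF tpd fine] c by (simp add: field_simps)
      finally show ?thesis .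
    qed
    define U where "U = (\<Union>i\<in>C. cball (m i) (r i))"
    have U: "U \<in> lmeasurable" "measure lebesgue U \<le> e"
      unfolding U_def
      by (rule fmeasurable_UN_bound[OF C(1) _ bound] measure_UN_bound[OF C(1) _ bound]; simp)+
    show "\<exists>T. E c \<subseteq> T \<and> T \<in> lmeasurable \<and> measure lebesgue T \<le> e"
    proof (intro exI[of _ "U \<union> (E c - U)"] conjI)
      have n: "negligible (E c - U)" using C(4) by (simp add: U_def)
      show "U \<union> (E c - U) \<in> lmeasurable"
        by (rule fmeasurable.Un[OF U(1) negligible_imp_measurable[OF n]])
      have "measure lebesgue (U \<union> (E c - U)) = measure lebesgue U"
        by (rule measure_negligible_symdiff[OF U(1)]) (rule negligible_subset[OF n], auto)
      then show "measure lebesgue (U \<union> (E c - U)) \<le> e" using U(2) by simp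
    qed auto
  qed
  define N where "N = (\<Union>n. E (1 / real (Suc n)))"
  have "negligible N" unfolding N_def by (rule negligible_countable_Union) (auto intro: negE)
  moreover have "(F has_vector_derivative f x) (at x)" if x: "x \<in> {a<..<b} - N" for x
  proof -
    have "(F has_vector_derivative f x) (at x within {a..b})"
      unfolding has_vector_derivative_def has_derivative_within_alt
    proof (intro conjI allI impI)
      show "bounded_linear (\<lambda>y. y *\<^sub>R f x)" by (rule bounded_linear_scaleR_left)
      fix e :: real assume "e > 0"
      then obtain n where n: "1 / real (Suc n) < e" using nat_approx_posE by blast
      have "x \<notin> E (1 / real (Suc n))" using x by (auto simp: N_def)
      then obtain d where d: "d > 0"
        "\<And>y. y \<in> {a..b} \<Longrightarrow> y \<noteq> x \<Longrightarrow> \<bar>y - x\<bar> < d \<Longrightarrow> \<not> bad (1 / real (Suc n)) x y"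
        using x unfolding E_def by blast
      show "\<exists>d>0. \<forall>y\<in>{a..b}. norm (y - x) < d \<longrightarrow> norm (F y - F x - (y - x) *\<^sub>R f x) \<le> e * norm (y - x)"
      proof (intro exI[of _ d] conjI ballI impI)
        fix y assume y: "y \<in> {a..b}" "norm (y - x) < d"
        show "norm (F y - F x - (y - x) *\<^sub>R f x) \<le> e * norm (y - x)"
        proof (cases "y = x")
          case False
          then have "norm (F y - F x - (y - x) *\<^sub>R f x) \<le> 1 / real (Suc n) * \<bar>y - x\<bar>"
            using d(2)[of y] y by (simp add: bad_def)
          also have "\<dots> \<le> e * \<bar>y - x\<bar>" using n by (intro mult_right_mono) auto
          finally show ?thesis by simp
        qed simp
      qed (rule d(1))
    qed
    then show ?thesis
      using x by (metis DiffD1 at_within_Icc_at greaterThanLessThan_iff)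
  qed
  ultimately show thesis using that unfolding F_def by blast
qed

section \<open>Trajectories of measurable controls\<close>

lemma lipschitz_imp_abs_continuous:
  fixes f :: "real \<Rightarrow> 'a::real_normed_vector"
  assumes lip: "\<And>x y. a \<le> x \<Longrightarrow> x \<le> y \<Longrightarrow> y \<le> b \<Longrightarrow> norm (f y - f x) \<le> B * (y - x)"
  shows "abs_continuous_fun a b f"
  unfolding abs_continuous_fun_def
proof (intro allI impI)
  fix \<epsilon> :: real assume \<epsilon>: "\<epsilon> > 0"
  define C where "C = max B 0 + 1"
  have C: "C > 0" "B \<le> C" by (auto simp: C_def)
  show "\<exists>\<delta>>0. \<forall>D. D division_of \<Union>D \<longrightarrow> \<Union>D \<subseteq> {a..b} \<longrightarrow> (\<Sum>K\<in>D. Sup K - Inf K) < \<delta>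
        \<longrightarrow> (\<Sum>K\<in>D. norm (f (Sup K) - f (Inf K))) < \<epsilon>"
  proof (intro exI[of _ "\<epsilon> / C"] conjI allI impI)
    fix D assume D: "D division_of \<Union>D" "\<Union>D \<subseteq> {a..b}" "(\<Sum>K\<in>D. Sup K - Inf K) < \<epsilon> / C"
    have "(\<Sum>K\<in>D. norm (f (Sup K) - f (Inf K))) \<le> (\<Sum>K\<in>D. C * (Sup K - Inf K))"
    proof (rule sum_mono)
      fix K assume K: "K \<in> D"
      obtain u v where uv: "K = cbox u v" using division_ofD(4)[OF D(1) K] by blast
      have "K \<noteq> {}" using division_ofD(3)[OF D(1) K] .
      then have le: "u \<le> v" using uv by simp
      have "K \<subseteq> {a..b}" using K D(2) by blast
      then have "a \<le> u" "v \<le> b" using uv le by auto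
      then have "norm (f v - f u) \<le> B * (v - u)" using lip le by blast
      also have "\<dots> \<le> C * (v - u)" using C le by (intro mult_right_mono) auto
      finally show "norm (f (Sup K) - f (Inf K)) \<le> C * (Sup K - Inf K)" using uv le by simp
    qed
    also have "\<dots> = C * (\<Sum>K\<in>D. Sup K - Inf K)" by (simp add: sum_distrib_left)
    also have "\<dots> < \<epsilon>" using D(3) C by (simp add: field_simps)
    finally show "(\<Sum>K\<in>D. norm (f (Sup K) - f (Inf K))) < \<epsilon>" .
  qed (use \<epsilon> C in auto)
qed

lemma AE_lebesgue_on_iff_negligible:
  assumes "S \<in> sets lebesgue"
  shows "(AE t in lebesgue_on S. P t) \<longleftrightarrow> (\<exists>N. negligible N \<and> (\<forall>t\<in>S - N. P t))"
proof -
  have "(AE t in lebesgue_on S. P t) \<longleftrightarrow> (AE t in lebesgue. t \<in> S \<longrightarrow> P t)"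
    using assms by (subst AE_restrict_space_iff) auto
  also have "\<dots> \<longleftrightarrow> (\<exists>N\<in>null_sets lebesgue. {t. \<not> (t \<in> S \<longrightarrow> P t)} \<subseteq> N)"
    by (simp add: eventually_ae_filter)
  also have "\<dots> \<longleftrightarrow> (\<exists>N. negligible N \<and> (\<forall>t\<in>S - N. P t))"
    by (auto simp: negligible_iff_null_sets)
  finally show ?thesis .
qed

lemma admissible_measurable:
  assumes "u \<in> admissible_controls"
  shows "u \<in> borel_measurable (lebesgue_on {0..T})"
proof -
  have "u \<in> borel_measurable (lebesgue_on {0..})" using assms by (simp add: admissible_controls_def)
  then show ?thesis by (rule measurable_restrict_mono) auto
qed

lemma admissible_norm_le: "u \<in> admissible_controls \<Longrightarrow> t \<ge> 0 \<Longrightarrow> norm (u t) \<le> 1"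
  by (simp add: admissible_controls_def)

lemma integrable_lebesgue_on_Icc:
  fixes f :: "real \<Rightarrow> 'a::{banach, second_countable_topology}"
  assumes "f \<in> borel_measurable (lebesgue_on {a..b})" "\<And>t. t \<in> {a..b} \<Longrightarrow> norm (f t) \<le> B"
  shows "integrable (lebesgue_on {a..b}) f"
proof -
  interpret finite_measure "lebesgue_on {a..b}" by (rule finite_measure_lebesgue_on) simp
  show ?thesis
    by (rule integrable_const_bound[where B = B]) (use assms in \<open>auto intro!: AE_I2\<close>)
qed

lemma integrable_control:
  assumes "u \<in> admissible_controls" "continuous_on {0..T} g"
  shows "integrable (lebesgue_on {0..T}) (\<lambda>s. g s *\<^sub>R u s)"
proof -
  have "bounded (g ` {0..T})"
    using assms(2) compact_continuous_image compact_imp_bounded compact_Icc by blast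
  then obtain B where B: "\<And>t. t \<in> {0..T} \<Longrightarrow> \<bar>g t\<bar> \<le> B" unfolding bounded_iff by force
  have "g \<in> borel_measurable (lebesgue_on {0..T})"
    by (rule continuous_imp_measurable_on_sets_lebesgue) (use assms in auto)
  then show ?thesis
  proof (intro integrable_lebesgue_on_Icc[where B = B])
    fix t assume t: "t \<in> {0..T}"
    have "\<bar>g t\<bar> * norm (u t) \<le> B * 1"
      using B[OF t] admissible_norm_le[OF assms(1), of t] t by (intro mult_mono) auto
    then show "norm (g t *\<^sub>R u t) \<le> B" by simp
  qed (use admissible_measurable[OF assms(1)] in auto)
qed

lemma integrable_on_control:
  assumes "u \<in> admissible_controls" "continuous_on {0..T} g"
  shows "(\<lambda>s. g s *\<^sub>R u s) integrable_on {0..T}"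
  using has_integral_integral_lebesgue_on[OF integrable_control[OF assms]] by auto

text \<open>All dependence on the control is through the two weights \<open>g = 1\<close> and \<open>g = exp\<close>.\<close>

definition impulse :: "(real \<Rightarrow> real) \<Rightarrow> (real \<Rightarrow> real^'n) \<Rightarrow> real \<Rightarrow> real^'n" where
  "impulse g u t = integral {0..t} (\<lambda>s. g s *\<^sub>R u s)"

text \<open>The Lipschitz bound makes trajectories absolutely continuous, via
\<open>lipschitz_imp_abs_continuous\<close>.\<close>

lemma impulse_lipschitz:
  assumes u: "u \<in> admissible_controls" and g: "continuous_on {0..T} g"
    and B: "\<And>t. t \<in> {0..T} \<Longrightarrow> \<bar>g t\<bar> \<le> B"
    and xy: "0 \<le> x" "x \<le> y" "y \<le> T"
  shows "norm (impulse g u y - impulse g u x) \<le> B * (y - x)"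
proof -
  have int: "(\<lambda>s. g s *\<^sub>R u s) integrable_on {0..y}"
    by (rule integrable_subinterval_real[OF integrable_on_control[OF u g]]) (use xy in auto)
  have "impulse g u x + integral {x..y} (\<lambda>s. g s *\<^sub>R u s) = impulse g u y"
    unfolding impulse_def
    by (rule Henstock_Kurzweil_Integration.integral_combine) (use xy int in auto)
  then have "norm (impulse g u y - impulse g u x) = norm (integral {x..y} (\<lambda>s. g s *\<^sub>R u s))"
    by (metis add_diff_cancel_left')
  also have "\<dots> \<le> B * (y - x)"
  proof -
    have "norm (integral (cbox x y) (\<lambda>s. g s *\<^sub>R u s)) \<le> B * measure lborel (cbox x y)"
    proof (rule has_integral_bound)
      have "\<bar>g 0\<bar> \<le> B" using B[of 0] xy by auto
      then show "0 \<le> B" by linarith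
      show "((\<lambda>s. g s *\<^sub>R u s) has_integral integral (cbox x y) (\<lambda>s. g s *\<^sub>R u s)) (cbox x y)"
        by (rule integrable_integral) (use integrable_subinterval_real[OF int] xy in auto)
      fix t assume t: "t \<in> cbox x y"
      have "\<bar>g t\<bar> * norm (u t) \<le> B * 1"
        using B[of t] admissible_norm_le[OF u, of t] t xy by (intro mult_mono) auto
      then show "norm (g t *\<^sub>R u t) \<le> B" by simp
    qed
    then show ?thesis using xy by simp
  qed
  finally show ?thesis .
qed

text \<open>The exceptional sets for the bounded intervals \<open>[0, n]\<close> are collected into one null set, which also
contains \<open>0\<close> so that two-sided derivatives are available outside it.\<close>

lemma impulse_has_derivative:
  assumes u: "u \<in> admissible_controls" and g: "continuous_on {0..} g"
  obtains N where "negligible N"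
    "\<And>t. t \<in> {0..} - N \<Longrightarrow> t > 0 \<and> (impulse g u has_vector_derivative g t *\<^sub>R u t) (at t)"
proof -
  have "\<exists>N. negligible N \<and> (\<forall>t\<in>{0<..<real n} - N. (impulse g u has_vector_derivative g t *\<^sub>R u t) (at t))" for n
  proof -
    have "(\<lambda>s. g s *\<^sub>R u s) integrable_on {0..real n}"
      by (rule integrable_on_control[OF u continuous_on_subset[OF g]]) auto
    then show ?thesis
      using indefinite_integral_has_derivative_except_negligible
      unfolding impulse_def[abs_def] by metis
  qed
  then obtain N where N: "\<And>n. negligible (N n)"
    "\<And>n t. t \<in> {0<..<real n} - N n \<Longrightarrow> (impulse g u has_vector_derivative g t *\<^sub>R u t) (at t)"
    by metis
  show thesis
  proof
    show "negligible (insert 0 (\<Union>n. N n))"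
      unfolding negligible_insert by (rule negligible_countable_Union) (auto intro: N(1))
    fix t :: real assume t: "t \<in> {0..} - insert 0 (\<Union>n. N n)"
    obtain n where "t < real n" using reals_Archimedean2 by blast
    then show "t > 0 \<and> (impulse g u has_vector_derivative g t *\<^sub>R u t) (at t)"
      using N(2)[of t n] t by auto
  qed
qed

definition velocity :: "real^'n \<Rightarrow> (real \<Rightarrow> real^'n) \<Rightarrow> real \<Rightarrow> real^'n" where
  "velocity w u t = exp (- t) *\<^sub>R (w + impulse exp u t)"

definition position :: "real^'n \<Rightarrow> (real \<Rightarrow> real^'n) \<Rightarrow> real \<Rightarrow> real^'n" where
  "position w u t = w - velocity w u t + impulse (\<lambda>_. 1) u t"

lemma impulse_0 [simp]: "impulse g u 0 = 0"
  by (simp add: impulse_def)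

lemma rocket_solution_exists:
  assumes u: "u \<in> admissible_controls"
  shows "rocket_solution k v0 u (position (axis k v0) u) (velocity (axis k v0) u)"
proof -
  let ?w = "axis k v0"
  define J where "J = impulse exp u"
  define I where "I = impulse (\<lambda>_. 1) u"
  have vel: "velocity ?w u = (\<lambda>t. exp (- t) *\<^sub>R (?w + J t))"
    by (simp add: velocity_def J_def fun_eq_iff)
  have pos: "position ?w u = (\<lambda>t. ?w - velocity ?w u t + I t)"
    by (simp add: position_def I_def fun_eq_iff)
  have ac: "abs_continuous_fun 0 T (position ?w u) \<and> abs_continuous_fun 0 T (velocity ?w u)" for T
  proof -
    have J: "norm (J y - J x) \<le> exp T * (y - x)" if "0 \<le> x" "x \<le> y" "y \<le> T" for x y
      unfolding J_def using that by (intro impulse_lipschitz[OF u]) (auto intro: continuous_intros)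
    have I: "norm (I y - I x) \<le> 1 * (y - x)" if "0 \<le> x" "x \<le> y" "y \<le> T" for x y
      unfolding I_def using that by (intro impulse_lipschitz[OF u]) (auto intro: continuous_intros)
    define B where "B = norm ?w + exp T * T + exp T"
    have V: "norm (velocity ?w u y - velocity ?w u x) \<le> B * (y - x)" if xy: "0 \<le> x" "x \<le> y" "y \<le> T" for x y
    proof -
      have "norm (J y) \<le> exp T * y" using J[of 0 y] xy by (simp add: J_def)
      also have "\<dots> \<le> exp T * T" using xy by simp
      finally have nJ: "norm (?w + J y) \<le> norm ?w + exp T * T"
        using norm_triangle_ineq[of ?w "J y"] by linarith
      have e1: "\<bar>exp (- y) - exp (- x)\<bar> \<le> y - x"
      proof -
        have h: "1 - exp (- (y - x)) \<le> y - x"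
          using exp_ge_add_one_self[of "- (y - x)"] by linarith
        have "exp (- x) - exp (- y) = exp (- x) * (1 - exp (- (y - x)))"
          by (simp add: algebra_simps flip: exp_add)
        also have "\<dots> \<le> 1 * (y - x)"
          using h xy by (intro mult_mono) auto
        finally show ?thesis using xy by simp
      qed
      have e2: "exp (- x) \<le> 1" using xy by simp
      have "velocity ?w u y - velocity ?w u x = (exp (- y) - exp (- x)) *\<^sub>R (?w + J y) + exp (- x) *\<^sub>R (J y - J x)"
        unfolding vel by (simp add: algebra_simps)
      also have "norm \<dots> \<le> \<bar>exp (- y) - exp (- x)\<bar> * norm (?w + J y) + exp (- x) * norm (J y - J x)"
        by (rule order_trans[OF norm_triangle_ineq]) simp
      also have "\<dots> \<le> (y - x) * (norm ?w + exp T * T) + 1 * (exp T * (y - x))"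
        using e1 nJ e2 J[OF xy] xy by (intro add_mono mult_mono) auto
      also have "\<dots> = B * (y - x)" by (simp add: B_def algebra_simps)
      finally show ?thesis .
    qed
    have P: "norm (position ?w u y - position ?w u x) \<le> (B + 1) * (y - x)" if xy: "0 \<le> x" "x \<le> y" "y \<le> T" for x y
    proof -
      have "position ?w u y - position ?w u x = (I y - I x) - (velocity ?w u y - velocity ?w u x)"
        by (simp add: pos)
      also have "norm \<dots> \<le> norm (I y - I x) + norm (velocity ?w u y - velocity ?w u x)"
        by (rule norm_triangle_ineq4)
      also have "\<dots> \<le> (B + 1) * (y - x)"
        using I[OF xy] V[OF xy] by (simp add: algebra_simps)
      finally show ?thesis .
    qed
    show ?thesis using V P by (blast intro: lipschitz_imp_abs_continuous)
  qed
  obtain M where M: "negligible M"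
    "\<And>t. t \<in> {0..} - M \<Longrightarrow> t > 0 \<and> (J has_vector_derivative exp t *\<^sub>R u t) (at t)"
    unfolding J_def using impulse_has_derivative[OF u, of exp] continuous_on_exp[OF continuous_on_id] by blast
  obtain N where N: "negligible N"
    "\<And>t. t \<in> {0..} - N \<Longrightarrow> t > 0 \<and> (I has_vector_derivative 1 *\<^sub>R u t) (at t)"
    unfolding I_def using impulse_has_derivative[OF u, of "\<lambda>_. 1"] by auto
  have "(position ?w u has_vector_derivative velocity ?w u t) (at t within {0..}) \<and>
        (velocity ?w u has_vector_derivative (u t - velocity ?w u t)) (at t within {0..})"
    if t: "t \<in> {0..} - (M \<union> N)" for t
  proof -
    have e: "((\<lambda>t. exp (- t)) has_real_derivative - exp (- t)) (at t)"
      by (auto intro!: derivative_eq_intros)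
    have dJ: "((\<lambda>s. ?w + J s) has_vector_derivative exp t *\<^sub>R u t) (at t)"
      using M(2)[of t] t by (auto intro!: derivative_eq_intros)
    have dv: "(velocity ?w u has_vector_derivative (u t - velocity ?w u t)) (at t)"
      using has_vector_derivative_scaleR[OF e dJ] unfolding vel by (simp add: flip: exp_add)
    have dI: "(I has_vector_derivative u t) (at t)" using N(2)[of t] t by simp
    have "(position ?w u has_vector_derivative (0 - (u t - velocity ?w u t) + u t)) (at t)"
      unfolding pos by (intro has_vector_derivative_add has_vector_derivative_diff has_vector_derivative_const dv dI)
    then show ?thesis using dv by (auto intro: has_vector_derivative_at_within)
  qed
  moreover have "negligible (M \<union> N)" using M(1) N(1) by simp
  ultimately have "AE t in lebesgue_on {0..}.
        (position ?w u has_vector_derivative velocity ?w u t) (at t within {0..}) \<and>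
        (velocity ?w u has_vector_derivative (u t - velocity ?w u t)) (at t within {0..})"
    by (subst AE_lebesgue_on_iff_negligible) (simp, blast)
  then show ?thesis
    unfolding rocket_solution_def using ac by (simp add: position_def velocity_def)
qed

text \<open>The difference of two velocities under the same control solves \<open>w' = - w\<close> in integrated form.
Integration upgrades \<open>w\<close> first to a continuous and then to a differentiable function, so that
\<open>e\<^sup>t w(t)\<close> may be differentiated everywhere; its derivative is \<open>0\<close>.\<close>

lemma linear_decay_eq_0:
  fixes w :: "real \<Rightarrow> 'a::euclidean_space"
  assumes T: "T \<ge> 0" and w: "\<And>t. t \<in> {0..T} \<Longrightarrow> ((\<lambda>s. - w s) has_integral w t) {0..t}"
  shows "w T = 0"
proof -
  have int: "(\<lambda>s. - w s) integrable_on {0..T}" using w[of T] T by auto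
  have eq: "integral {0..t} (\<lambda>s. - w s) = w t" if "t \<in> {0..T}" for t
    using w[OF that] by (rule integral_unique)
  have cw: "continuous_on {0..T} w"
    by (rule continuous_on_eq[OF indefinite_integral_continuous_1[OF int]]) (rule eq)
  have dw: "(w has_vector_derivative - w t) (at t within {0..T})" if t: "t \<in> {0..T}" for t
    using integral_has_vector_derivative[OF continuous_on_minus[OF cw] t]
    by (rule has_vector_derivative_transform[OF t, rotated]) (rule eq[symmetric])
  have "((\<lambda>s. exp s *\<^sub>R w s) has_vector_derivative 0) (at t within {0..T})" if t: "t \<in> {0..T}" for t
  proof -
    have "(exp has_real_derivative exp t) (at t within {0..T})" by (auto intro!: derivative_eq_intros)
    from has_vector_derivative_scaleR[OF this dw[OF t]] show ?thesis by simp
  qed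
  then obtain c where c: "\<And>t. t \<in> {0..T} \<Longrightarrow> exp t *\<^sub>R w t = c"
    using has_vector_derivative_zero_constant[of "{0..T}" "\<lambda>s. exp s *\<^sub>R w s"] convex_real_interval(5)
    by blast
  have "w 0 = 0" using eq[of 0] T by simp
  then show ?thesis using c[of 0] c[of T] T by simp
qed

lemma rocket_solution_has_integral:
  assumes "rocket_solution k v0 u r v" "t \<ge> 0"
  shows "((\<lambda>s. u s - v s) has_integral (v t - axis k v0)) {0..t}" "(v has_integral r t) {0..t}"
proof -
  obtain N where N: "negligible N"
    and d: "\<And>s. s \<in> {0..} - N \<Longrightarrow> (r has_vector_derivative v s) (at s within {0..}) \<and>
        (v has_vector_derivative (u s - v s)) (at s within {0..})"
    using assms(1) unfolding rocket_solution_def by (subst (asm) AE_lebesgue_on_iff_negligible) auto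
  have "(v has_vector_derivative (u s - v s)) (at s within {0..t})"
    "(r has_vector_derivative v s) (at s within {0..t})" if "s \<in> {0..t} - N" for s
    using d[of s] that by (auto intro: has_vector_derivative_within_subset)
  then have "((\<lambda>s. u s - v s) has_integral (v t - v 0)) {0..t}" "(v has_integral (r t - r 0)) {0..t}"
    using assms N unfolding rocket_solution_def
    by (meson abs_continuous_imp_has_integral)+
  then show "((\<lambda>s. u s - v s) has_integral (v t - axis k v0)) {0..t}" "(v has_integral r t) {0..t}"
    using assms(1) by (auto simp: rocket_solution_def)
qed

lemma rocket_solution_unique:
  assumes 1: "rocket_solution k v0 u r v" and 2: "rocket_solution k v0 u r' v'" and t: "t \<ge> 0"
  shows "v t = v' t" "r t = r' t"
proof -
  have v: "v s = v' s" if s: "s \<ge> 0" for s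
  proof -
    have "((\<lambda>x. - (v x - v' x)) has_integral v s - v' s) {0..s}" if "s \<ge> 0" for s
      using has_integral_diff[OF rocket_solution_has_integral(1)[OF 1 that] rocket_solution_has_integral(1)[OF 2 that]]
      by simp
    then have "v s - v' s = 0" using linear_decay_eq_0[of s "\<lambda>x. v x - v' x"] s by auto
    then show ?thesis by simp
  qed
  show "v t = v' t" using v t by simp
  have "(v has_integral r' t) {0..t}"
    by (rule has_integral_eq[OF _ rocket_solution_has_integral(2)[OF 2 t]]) (simp add: v)
  then show "r t = r' t" by (rule has_integral_unique[OF rocket_solution_has_integral(2)[OF 1 t]])
qed

lemma rocket_vel_eq:
  assumes u: "u \<in> admissible_controls" and t: "t \<ge> 0"
  shows "rocket_vel k v0 u t = velocity (axis k v0) u t"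
  unfolding rocket_vel_def
proof (rule the_equality)
  note sol = rocket_solution_exists[OF u, of k v0]
  then show "\<exists>r v. rocket_solution k v0 u r v \<and> v t = velocity (axis k v0) u t"
    by (intro exI conjI) (rule sol, rule refl)
  fix x assume "\<exists>r v. rocket_solution k v0 u r v \<and> v t = x"
  then obtain r v where "rocket_solution k v0 u r v" "v t = x" by (elim exE conjE)
  then show "x = velocity (axis k v0) u t"
    using rocket_solution_unique(1)[OF _ sol t, of r v] by simp
qed

lemma rocket_pos_eq:
  assumes u: "u \<in> admissible_controls" and t: "t \<ge> 0"
  shows "rocket_pos k v0 u t = position (axis k v0) u t"
  unfolding rocket_pos_def
proof (rule the_equality)
  note sol = rocket_solution_exists[OF u, of k v0]
  then show "\<exists>r v. rocket_solution k v0 u r v \<and> r t = position (axis k v0) u t"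
    by (intro exI conjI) (rule sol, rule refl)
  fix x assume "\<exists>r v. rocket_solution k v0 u r v \<and> r t = x"
  then obtain r v where "rocket_solution k v0 u r v" "r t = x" by (elim exE conjE)
  then show "x = position (axis k v0) u t"
    using rocket_solution_unique(2)[OF _ sol t, of r v] by simp
qed

section \<open>Extremal trajectories in closed form\<close>

lemma has_vector_derivative_scaleR_left:
  assumes "(f has_real_derivative f') (at s)"
  shows "((\<lambda>s. f s *\<^sub>R w) has_vector_derivative f' *\<^sub>R w) (at s)"
  using has_vector_derivative_scaleR[OF assms has_vector_derivative_const[of w]] by simp

lemma has_real_derivative_abs:
  fixes f :: "real \<Rightarrow> real"
  assumes "(f has_real_derivative f') (at s)" "f s \<noteq> 0"
  shows "((\<lambda>s. \<bar>f s\<bar>) has_real_derivative f' * sgn (f s)) (at s)"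
  using has_derivative_compose[OF assms(1)[unfolded has_field_derivative_def] has_derivative_norm[OF assms(2)]]
  unfolding has_field_derivative_def real_norm_def
  by (rule has_derivative_eq_rhs) (simp add: fun_eq_iff)

text \<open>Lets any primitive of the normalised costate, differentiable outside finitely many times, compute the
impulse of an extremal control; the finite set accommodates the switching time.\<close>

lemma extremal_impulse:
  assumes ex: "extremal_control T p u" and t: "0 \<le> t" "t \<le> T"
    and S: "finite S" and cont: "continuous_on {0..t} A"
    and der: "\<And>s. s \<in> {0<..<t} - S \<Longrightarrow>
      (A has_vector_derivative g s *\<^sub>R sgn (costate T (fst p) (snd p) s)) (at s)"
  shows "impulse g u t = A t - A 0"
proof -
  obtain N where N: "negligible N"
    "\<And>s. s \<in> {0..T} - N \<Longrightarrow> u s = sgn (costate T (fst p) (snd p) s)"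
    using ex unfolding extremal_control_def sgn_div_norm
    by (subst (asm) AE_lebesgue_on_iff_negligible) auto
  have "((\<lambda>s. g s *\<^sub>R sgn (costate T (fst p) (snd p) s)) has_integral (A t - A 0)) {0..t}"
    using S t(1) der cont by (rule fundamental_theorem_of_calculus_interior_strong)
  then have "((\<lambda>s. g s *\<^sub>R u s) has_integral (A t - A 0)) {0..t}"
    by (rule has_integral_spike[OF N(1), rotated]) (use N(2) t in auto)
  then show ?thesis unfolding impulse_def by (rule integral_unique)
qed

lemma extremal_impulse_const:
  assumes ex: "extremal_control T p u" and t: "0 \<le> t" "t \<le> T"
    and w: "\<And>s. s < T \<Longrightarrow> sgn (costate T (fst p) (snd p) s) = w"
  shows "impulse (\<lambda>_. 1) u t = t *\<^sub>R w" "impulse exp u t = (exp t - 1) *\<^sub>R w"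
proof -
  have "impulse (\<lambda>_. 1) u t = t *\<^sub>R w - 0 *\<^sub>R w"
    by (rule extremal_impulse[OF ex t, of "{}"]) (use w t in \<open>auto intro!: derivative_eq_intros continuous_intros\<close>)
  then show "impulse (\<lambda>_. 1) u t = t *\<^sub>R w" by simp
  have "impulse exp u t = exp t *\<^sub>R w - exp 0 *\<^sub>R w"
    by (rule extremal_impulse[OF ex t, of "{}"]) (use w t in \<open>auto intro!: derivative_eq_intros continuous_intros\<close>)
  then show "impulse exp u t = (exp t - 1) *\<^sub>R w" by (simp add: algebra_simps)
qed

text \<open>The Gram determinant is the quantitative form of linear independence best suited here: it changes
by an explicit positive factor under the passage from \<open>\<eta>\<^sub>T\<close> to \<open>\<eta>(s)\<close>, so strictness in the
Cauchy-Schwarz inequality propagates to all times.\<close>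

definition gram :: "'a::real_inner \<Rightarrow> 'a \<Rightarrow> real" where
  "gram x y = (x \<bullet> x) * (y \<bullet> y) - (x \<bullet> y)\<^sup>2"

lemma gram_pos_iff: "gram x y > 0 \<longleftrightarrow> \<bar>x \<bullet> y\<bar> < norm x * norm y"
proof -
  have "gram x y = (norm x * norm y)\<^sup>2 - \<bar>x \<bullet> y\<bar>\<^sup>2"
    by (simp add: gram_def power_mult_distrib power2_norm_eq_inner)
  moreover have "\<bar>x \<bullet> y\<bar>\<^sup>2 < (norm x * norm y)\<^sup>2 \<longleftrightarrow> \<bar>x \<bullet> y\<bar> < norm x * norm y"
    using power2_less_imp_less[of "\<bar>x \<bullet> y\<bar>" "norm x * norm y"]
      power_strict_mono[of "\<bar>x \<bullet> y\<bar>" "norm x * norm y" 2] by auto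
  ultimately show ?thesis by auto
qed

lemma gram_costate: "gram lam (costate T lam eta s) = (exp (s - T))\<^sup>2 * gram lam eta"
  "gram (eta - lam) (costate T lam eta s) = gram lam eta"
  unfolding gram_def costate_def
  by (simp_all add: inner_add inner_diff inner_commute[of eta lam] power2_eq_square algebra_simps)

text \<open>With \<open>l = |\<lambda>\<^sub>T|\<close>, \<open>x = |\<xi>\<^sub>T|\<close>, \<open>m = (\<lambda>\<^sub>T, \<xi>\<^sub>T)\<close> and \<open>E = e\<^sup>s\<^sup>-\<^sup>T\<close>, the function \<open>N\<close> is \<open>|\<eta>(s)|\<close>, and the
two arguments of the logarithm are \<open>|\<xi>\<^sub>T| |\<eta>| + (\<xi>\<^sub>T, \<eta>)\<close> and \<open>|\<lambda>\<^sub>T| |\<eta>| + (\<lambda>\<^sub>T, \<eta>)\<close>. The derivatives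
simplify because \<open>N\<^sup>2\<close> is a quadratic polynomial in \<open>E\<close>, so that the arguments cancel.\<close>

lemma costate_primitives:
  fixes l m x T :: real
  defines "E \<equiv> \<lambda>s. exp (s - T)"
  defines "N \<equiv> \<lambda>s. sqrt (l\<^sup>2 + 2 * m * E s + x\<^sup>2 * (E s)\<^sup>2)"
  assumes N: "N s > 0"
  shows "(N has_real_derivative (m * E s + x\<^sup>2 * (E s)\<^sup>2) / N s) (at s)"
    and "x * N s + (m + x\<^sup>2 * E s) > 0 \<Longrightarrow>
      ((\<lambda>s. ln (x * N s + (m + x\<^sup>2 * E s))) has_real_derivative x * E s / N s) (at s)"
    and "l * N s + (l\<^sup>2 + m * E s) > 0 \<Longrightarrow>
      ((\<lambda>s. s - ln (l * N s + (l\<^sup>2 + m * E s))) has_real_derivative l / N s) (at s)"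
proof -
  have cancel: "inverse P * (P * z) = z" if "P > 0" for P z :: real
    using that by simp
  let ?q = "l\<^sup>2 + 2 * m * E s + x\<^sup>2 * (E s)\<^sup>2"
  have E: "(E has_real_derivative E s) (at s)"
    unfolding E_def by (auto intro!: derivative_eq_intros)
  have q: "?q > 0" using N unfolding N_def by simp
  have NN: "N s * N s = ?q" using q unfolding N_def by (simp add: less_imp_le)
  have E2: "((\<lambda>s. (E s)\<^sup>2) has_real_derivative 2 * (E s * E s)) (at s)"
    using DERIV_mult[OF E E] by (simp add: power2_eq_square)
  have dq: "((\<lambda>s. l\<^sup>2 + 2 * m * E s + x\<^sup>2 * (E s)\<^sup>2) has_real_derivative 2 * (m * E s + x\<^sup>2 * (E s)\<^sup>2)) (at s)"
    by (rule DERIV_cong[OF DERIV_add[OF DERIV_add[OF DERIV_const DERIV_cmult[OF E]] DERIV_cmult[OF E2]]])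
       (simp add: algebra_simps power2_eq_square)
  show dN: "(N has_real_derivative (m * E s + x\<^sup>2 * (E s)\<^sup>2) / N s) (at s)"
    unfolding N_def
  proof (rule DERIV_cong[OF DERIV_chain2[OF DERIV_real_sqrt[OF q] dq]])
    have "inverse b / 2 * (2 * z) = z / b" for b z :: real by (simp add: divide_simps)
    then show "inverse (sqrt ?q) / 2 * (2 * (m * E s + x\<^sup>2 * (E s)\<^sup>2)) = (m * E s + x\<^sup>2 * (E s)\<^sup>2) / sqrt ?q" .
  qed
  show "((\<lambda>s. ln (x * N s + (m + x\<^sup>2 * E s))) has_real_derivative x * E s / N s) (at s)"
    if pos: "x * N s + (m + x\<^sup>2 * E s) > 0"
  proof -
    have "((\<lambda>s. ln (x * N s + (m + x\<^sup>2 * E s))) has_real_derivative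
       inverse (x * N s + (m + x\<^sup>2 * E s)) * (x * ((m * E s + x\<^sup>2 * (E s)\<^sup>2) / N s) + (0 + x\<^sup>2 * E s))) (at s)"
      by (rule DERIV_chain2[OF DERIV_ln[OF pos]
            DERIV_add[OF DERIV_cmult[OF dN] DERIV_add[OF DERIV_const DERIV_cmult[OF E]]]])
    moreover have "x * ((m * E s + x\<^sup>2 * (E s)\<^sup>2) / N s) + (0 + x\<^sup>2 * E s)
        = (x * N s + (m + x\<^sup>2 * E s)) * (x * E s / N s)"
      using N by (simp add: field_simps power2_eq_square)
    ultimately show ?thesis by (simp only: cancel[OF pos])
  qed
  show "((\<lambda>s. s - ln (l * N s + (l\<^sup>2 + m * E s))) has_real_derivative l / N s) (at s)"
    if pos: "l * N s + (l\<^sup>2 + m * E s) > 0"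
  proof -
    have "((\<lambda>s. s - ln (l * N s + (l\<^sup>2 + m * E s))) has_real_derivative
       1 - inverse (l * N s + (l\<^sup>2 + m * E s)) * (l * ((m * E s + x\<^sup>2 * (E s)\<^sup>2) / N s) + (0 + m * E s))) (at s)"
      by (rule DERIV_diff[OF DERIV_ident DERIV_chain2[OF DERIV_ln[OF pos]
            DERIV_add[OF DERIV_cmult[OF dN] DERIV_add[OF DERIV_const DERIV_cmult[OF E]]]]])
    moreover have "l * ((m * E s + x\<^sup>2 * (E s)\<^sup>2) / N s) + (0 + m * E s)
        = (l * N s + (l\<^sup>2 + m * E s)) * (1 - l / N s)"
    proof -
      have "N s * (l * ((m * E s + x\<^sup>2 * (E s)\<^sup>2) / N s) + m * E s)
          = l * (m * E s + x\<^sup>2 * (E s)\<^sup>2) + m * E s * N s"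
        using N by (simp add: field_simps)
      also have "\<dots> = l * (N s * N s - l\<^sup>2 - m * E s) + m * E s * N s"
        unfolding NN by (simp add: algebra_simps)
      also have "\<dots> = N s * ((l * N s + (l\<^sup>2 + m * E s)) * (1 - l / N s))"
        using N by (simp add: field_simps power2_eq_square)
      finally show ?thesis using N by simp
    qed
    ultimately show ?thesis by (simp add: cancel[OF pos])
  qed
qed

text \<open>Since \<open>\<eta>/|\<eta>| = (|\<lambda>\<^sub>T|/|\<eta>|) \<lambda>\<^sub>T/|\<lambda>\<^sub>T| + (|\<xi>\<^sub>T| e\<^sup>s\<^sup>-\<^sup>T/|\<eta>|) \<xi>\<^sub>T/|\<xi>\<^sub>T|\<close>, the scalar primitives assemble to the
first impulse. For the weight \<open>e\<^sup>s\<close>, split \<open>\<lambda>\<^sub>T\<close> into its component along \<open>\<xi>\<^sub>T\<close>, which combines with the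
derivative of \<open>|\<eta>|\<close>, and the orthogonal remainder, which carries the logarithm.\<close>

lemma extremal_impulse_generic:
  fixes lam eta :: "real^'n" and T :: real
  defines "c \<equiv> costate T lam eta" and "xi \<equiv> eta - lam"
  assumes ex: "extremal_control T (lam, eta) u" and t: "0 \<le> t" "t \<le> T"
    and indep: "\<bar>lam \<bullet> eta\<bar> < norm lam * norm eta"
  defines "L \<equiv> ln ((norm xi * norm (c t) + xi \<bullet> c t) / (norm xi * norm (c 0) + xi \<bullet> c 0))"
  shows "impulse exp u t = (exp T * (norm (c t) - norm (c 0)) / (norm xi)\<^sup>2) *\<^sub>R xi
      + (exp T * L) *\<^sub>R ((1 / norm xi) *\<^sub>R lam - ((lam \<bullet> xi) / norm xi ^ 3) *\<^sub>R xi)"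
    and "impulse (\<lambda>_. 1) u t = (t + ln ((norm lam * norm (c 0) + lam \<bullet> c 0) /
                         (norm lam * norm (c t) + lam \<bullet> c t))) *\<^sub>R (lam /\<^sub>R norm lam)
              + L *\<^sub>R (xi /\<^sub>R norm xi)"
proof -
  have G: "gram lam eta > 0" using indep by (simp add: gram_pos_iff)
  have pl: "norm lam * norm (c s) + lam \<bullet> c s > 0" for s
    using gram_costate(1)[of lam T eta s] G gram_pos_iff[of lam "c s"] unfolding c_def by simp
  have px: "norm xi * norm (c s) + xi \<bullet> c s > 0" for s
    using gram_costate(2)[of eta lam T s] G gram_pos_iff[of xi "c s"] unfolding c_def xi_def by simp
  have c0: "norm (c s) > 0" for s using pl[of s] by auto
  have x0: "norm xi > 0" and l0: "norm lam > 0" using pl[of 0] px[of 0] by auto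
  define E where "E s = exp (s - T)" for s
  have c: "c s = lam + E s *\<^sub>R xi" for s by (simp add: c_def xi_def E_def costate_def)
  define m where "m = lam \<bullet> xi"
  have Nc: "norm (c s) = sqrt ((norm lam)\<^sup>2 + 2 * m * E s + (norm xi)\<^sup>2 * (E s)\<^sup>2)" for s
  proof -
    have "c s \<bullet> c s = (norm lam)\<^sup>2 + 2 * m * E s + (norm xi)\<^sup>2 * (E s)\<^sup>2"
      unfolding c m_def power2_norm_eq_inner
      by (simp add: inner_add inner_commute[of xi lam] power2_eq_square algebra_simps)
    then show ?thesis by (simp only: norm_eq_sqrt_inner[of "c s"])
  qed
  have ic: "xi \<bullet> c s = m + (norm xi)\<^sup>2 * E s" "lam \<bullet> c s = (norm lam)\<^sup>2 + m * E s" for s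
    unfolding c m_def power2_norm_eq_inner by (simp_all add: inner_add_right inner_commute[of xi lam])
  note prim = costate_primitives[where l = "norm lam" and m = m and x = "norm xi" and T = T, folded E_def, folded Nc]
  have dN: "((\<lambda>s. norm (c s)) has_real_derivative (m * E s + (norm xi)\<^sup>2 * (E s)\<^sup>2) / norm (c s)) (at s)" for s
    using prim(1)[OF c0] .
  have dX: "((\<lambda>s. ln (norm xi * norm (c s) + xi \<bullet> c s)) has_real_derivative norm xi * E s / norm (c s)) (at s)" for s
    using prim(2)[OF c0] px[of s] unfolding ic by simp
  have dL: "((\<lambda>s. s - ln (norm lam * norm (c s) + lam \<bullet> c s)) has_real_derivative norm lam / norm (c s)) (at s)" for s
    using prim(3)[OF c0] pl[of s] unfolding ic by simp
  define X where "X s = ln (norm xi * norm (c s) + xi \<bullet> c s)" for s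
  define Y where "Y s = s - ln (norm lam * norm (c s) + lam \<bullet> c s)" for s
  have nz: "norm xi * norm (c s) + xi \<bullet> c s \<noteq> 0" "norm lam * norm (c s) + lam \<bullet> c s \<noteq> 0" for s
    using px[of s] pl[of s] by linarith+
  have L: "L = X t - X 0" unfolding L_def X_def by (simp add: ln_div nz)
  have Yd: "t + ln ((norm lam * norm (c 0) + lam \<bullet> c 0) / (norm lam * norm (c t) + lam \<bullet> c t)) = Y t - Y 0"
    unfolding Y_def by (simp add: ln_div nz)
  define A where "A s = Y s *\<^sub>R (lam /\<^sub>R norm lam) + X s *\<^sub>R (xi /\<^sub>R norm xi)" for s
  have dA: "(A has_vector_derivative 1 *\<^sub>R sgn (c s)) (at s)" for s
  proof -
    have "(A has_vector_derivative (norm lam / norm (c s)) *\<^sub>R (lam /\<^sub>R norm lam)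
        + (norm xi * E s / norm (c s)) *\<^sub>R (xi /\<^sub>R norm xi)) (at s)"
      unfolding A_def
      by (intro has_vector_derivative_add has_vector_derivative_scaleR_left)
         (use dX dL in \<open>simp_all add: X_def[abs_def] Y_def[abs_def]\<close>)
    moreover have "(norm lam / norm (c s)) *\<^sub>R (lam /\<^sub>R norm lam)
        + (norm xi * E s / norm (c s)) *\<^sub>R (xi /\<^sub>R norm xi) = sgn (c s)"
      using l0 x0 by (simp add: sgn_div_norm c algebra_simps divide_simps)
    ultimately show ?thesis by simp
  qed
  define W where "W = (1 / norm xi) *\<^sub>R lam - ((lam \<bullet> xi) / norm xi ^ 3) *\<^sub>R xi"
  define B where "B s = (exp T * norm (c s) / (norm xi)\<^sup>2) *\<^sub>R xi + (exp T * X s) *\<^sub>R W" for s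
  have dB: "(B has_vector_derivative exp s *\<^sub>R sgn (c s)) (at s)" for s
  proof -
    have d1: "((\<lambda>s. exp T * norm (c s) / (norm xi)\<^sup>2) has_real_derivative
        exp T * ((m * E s + (norm xi)\<^sup>2 * (E s)\<^sup>2) / norm (c s)) / (norm xi)\<^sup>2) (at s)"
      by (intro DERIV_cdivide DERIV_cmult dN)
    have d2: "((\<lambda>s. exp T * X s) has_real_derivative exp T * (norm xi * E s / norm (c s))) (at s)"
      unfolding X_def by (intro DERIV_cmult dX)
    have "(B has_vector_derivative (exp T * ((m * E s + (norm xi)\<^sup>2 * (E s)\<^sup>2) / norm (c s)) / (norm xi)\<^sup>2) *\<^sub>R xi
        + (exp T * (norm xi * E s / norm (c s))) *\<^sub>R W) (at s)"
      unfolding B_def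
      by (intro has_vector_derivative_add has_vector_derivative_scaleR_left)
         (use d1 d2 in simp_all)
    moreover have "(exp T * ((m * E s + (norm xi)\<^sup>2 * (E s)\<^sup>2) / norm (c s)) / (norm xi)\<^sup>2) *\<^sub>R xi
        + (exp T * (norm xi * E s / norm (c s))) *\<^sub>R W = exp s *\<^sub>R sgn (c s)"
    proof -
      have "(exp T * (norm xi * E s / norm (c s))) *\<^sub>R W
        = (exp T * E s / norm (c s)) *\<^sub>R lam - (exp T * E s / norm (c s) * (m / (norm xi)\<^sup>2)) *\<^sub>R xi"
        unfolding W_def m_def[symmetric] using x0
        by (simp add: scaleR_diff_right power2_eq_square power3_eq_cube)
      moreover have "exp T * ((m * E s + (norm xi)\<^sup>2 * (E s)\<^sup>2) / norm (c s)) / (norm xi)\<^sup>2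
        = exp T * E s / norm (c s) * (m / (norm xi)\<^sup>2) + exp T * E s / norm (c s) * E s"
        using x0 c0[of s] by (simp add: field_simps power2_eq_square)
      moreover have "exp T * E s = exp s" by (simp add: E_def flip: exp_add)
      ultimately show ?thesis
        by (simp add: sgn_div_norm c scaleR_add_left scaleR_add_right divide_inverse mult.commute)
    qed
    ultimately show ?thesis by simp
  qed
  have "impulse (\<lambda>_. 1) u t = A t - A 0"
    by (rule extremal_impulse[OF ex t, of "{}"])
       (use dA in \<open>auto simp: c_def intro!: continuous_at_imp_continuous_on has_vector_derivative_continuous\<close>)
  then show "impulse (\<lambda>_. 1) u t = (t + ln ((norm lam * norm (c 0) + lam \<bullet> c 0) /
                         (norm lam * norm (c t) + lam \<bullet> c t))) *\<^sub>R (lam /\<^sub>R norm lam)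
              + L *\<^sub>R (xi /\<^sub>R norm xi)"
    unfolding Yd L A_def by (simp add: algebra_simps)
  have "impulse exp u t = B t - B 0"
    by (rule extremal_impulse[OF ex t, of "{}"])
       (use dB in \<open>auto simp: c_def intro!: continuous_at_imp_continuous_on has_vector_derivative_continuous\<close>)
  then show "impulse exp u t = (exp T * (norm (c t) - norm (c 0)) / (norm xi)\<^sup>2) *\<^sub>R xi
      + (exp T * L) *\<^sub>R ((1 / norm xi) *\<^sub>R lam - ((lam \<bullet> xi) / norm xi ^ 3) *\<^sub>R xi)"
    unfolding L B_def W_def[symmetric]
    by (simp add: scaleR_diff_left diff_divide_distrib right_diff_distrib)
qed

text \<open>When \<open>\<eta>\<^sub>T\<close> is a nonpositive multiple of \<open>\<lambda>\<^sub>T\<close>, the costate equals \<open>(1 - e\<^sup>s\<^sup>-\<^sup>\<theta>) \<lambda>\<^sub>T\<close>: the thrust is along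
\<open>\<lambda>\<^sub>T\<close> before \<open>\<theta>\<close> and against it afterwards. The primitives \<open>- |s - \<theta>|\<close> and \<open>- |e\<^sup>s - e\<^sup>\<theta>|\<close> are valid
whether or not \<open>\<theta>\<close> lies in the time interval.\<close>

lemma extremal_impulse_opposite:
  fixes lam eta :: "real^'n" and T :: real
  assumes ex: "extremal_control T (lam, eta) u" and t: "0 \<le> t" "t \<le> T"
    and opp: "norm lam * norm eta = - (lam \<bullet> eta)" and lam: "lam \<noteq> 0"
  defines "\<theta> \<equiv> T + ln (norm lam / (norm lam + norm eta))"
  shows "impulse exp u t = (\<bar>1 - exp \<theta>\<bar> - \<bar>exp t - exp \<theta>\<bar>) *\<^sub>R (lam /\<^sub>R norm lam)"
    and "impulse (\<lambda>_. 1) u t = (\<bar>\<theta>\<bar> - \<bar>t - \<theta>\<bar>) *\<^sub>R (lam /\<^sub>R norm lam)"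
proof -
  have l0: "norm lam > 0" using lam by simp
  have "lam \<bullet> (- eta) = norm lam * norm (- eta)" using opp by simp
  then have "norm lam *\<^sub>R (- eta) = norm (- eta) *\<^sub>R lam" by (simp only: norm_cauchy_schwarz_eq)
  then have "norm lam *\<^sub>R eta = - (norm eta *\<^sub>R lam)" by (simp add: minus_equation_iff)
  then have "inverse (norm lam) *\<^sub>R (norm lam *\<^sub>R eta) = inverse (norm lam) *\<^sub>R (- (norm eta *\<^sub>R lam))"
    by (rule arg_cong)
  then have eta: "eta = - ((norm eta / norm lam) *\<^sub>R lam)"
    using l0 by (simp add: divide_inverse mult.commute)
  have eth: "exp (- \<theta>) = exp (- T) * ((norm lam + norm eta) / norm lam)"
  proof -
    have "norm lam / (norm lam + norm eta) > 0" using l0 by (simp add: add_pos_nonneg)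
    then have "exp \<theta> = exp T * (norm lam / (norm lam + norm eta))"
      by (simp add: \<theta>_def exp_add)
    then show ?thesis by (simp only: exp_minus inverse_mult_distrib inverse_divide)
  qed
  have c: "costate T lam eta s = (1 - exp (s - \<theta>)) *\<^sub>R lam" for s
  proof -
    have "exp (s - \<theta>) = exp (s - T) * (1 + norm eta / norm lam)"
    proof -
      have "exp (s - \<theta>) = exp s * exp (- \<theta>)" by (simp flip: exp_add)
      also have "\<dots> = (exp s * exp (- T)) * (1 + norm eta / norm lam)"
        unfolding eth using l0 by (simp add: add_divide_distrib)
      finally show ?thesis by (simp flip: exp_add)
    qed
    then show ?thesis
      unfolding costate_def by (subst eta) (simp add: algebra_simps)
  qed
  have sg: "sgn (costate T lam eta s) = sgn (\<theta> - s) *\<^sub>R (lam /\<^sub>R norm lam)" for s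
  proof -
    have "sgn (1 - exp (s - \<theta>)) = sgn (\<theta> - s)" by (simp add: sgn_real_def)
    then show ?thesis unfolding c sgn_scaleR by (simp add: sgn_div_norm)
  qed
  have "impulse (\<lambda>_. 1) u t = (- \<bar>t - \<theta>\<bar>) *\<^sub>R (lam /\<^sub>R norm lam) - (- \<bar>0 - \<theta>\<bar>) *\<^sub>R (lam /\<^sub>R norm lam)"
  proof (rule extremal_impulse[OF ex t, of "{\<theta>}"])
    fix s assume "s \<in> {0<..<t} - {\<theta>}"
    then have "((\<lambda>s. - \<bar>s - \<theta>\<bar>) has_real_derivative sgn (\<theta> - s)) (at s)"
      by (intro DERIV_cong[OF DERIV_minus[OF has_real_derivative_abs[of "\<lambda>s. s - \<theta>" 1 s]]])
         (auto simp: sgn_real_def intro!: derivative_eq_intros)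
    then show "((\<lambda>s. (- \<bar>s - \<theta>\<bar>) *\<^sub>R (lam /\<^sub>R norm lam)) has_vector_derivative
        1 *\<^sub>R sgn (costate T (fst (lam, eta)) (snd (lam, eta)) s)) (at s)"
      unfolding fst_conv snd_conv sg scaleR_one
      by (rule has_vector_derivative_scaleR_left)
  qed (auto intro!: continuous_intros)
  then show "impulse (\<lambda>_. 1) u t = (\<bar>\<theta>\<bar> - \<bar>t - \<theta>\<bar>) *\<^sub>R (lam /\<^sub>R norm lam)"
    by (simp add: algebra_simps)
  have "impulse exp u t = (- \<bar>exp t - exp \<theta>\<bar>) *\<^sub>R (lam /\<^sub>R norm lam) - (- \<bar>exp 0 - exp \<theta>\<bar>) *\<^sub>R (lam /\<^sub>R norm lam)"
  proof (rule extremal_impulse[OF ex t, of "{\<theta>}"])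
    fix s assume "s \<in> {0<..<t} - {\<theta>}"
    then have "((\<lambda>s. - \<bar>exp s - exp \<theta>\<bar>) has_real_derivative exp s * sgn (\<theta> - s)) (at s)"
      by (intro DERIV_cong[OF DERIV_minus[OF has_real_derivative_abs[of "\<lambda>s. exp s - exp \<theta>" "exp s" s]]])
         (auto simp: sgn_real_def intro!: derivative_eq_intros)
    moreover have "exp s *\<^sub>R sgn (costate T lam eta s) = (exp s * sgn (\<theta> - s)) *\<^sub>R (lam /\<^sub>R norm lam)"
      by (simp add: sg)
    ultimately show "((\<lambda>s. (- \<bar>exp s - exp \<theta>\<bar>) *\<^sub>R (lam /\<^sub>R norm lam)) has_vector_derivative
        exp s *\<^sub>R sgn (costate T (fst (lam, eta)) (snd (lam, eta)) s)) (at s)"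
      by (simp only: fst_conv snd_conv has_vector_derivative_scaleR_left)
  qed (auto intro!: continuous_intros)
  then show "impulse exp u t = (\<bar>1 - exp \<theta>\<bar> - \<bar>exp t - exp \<theta>\<bar>) *\<^sub>R (lam /\<^sub>R norm lam)"
    by (simp add: algebra_simps)
qed

lemma sgn_costate_aligned:
  fixes lam eta :: "real^'n"
  assumes al: "norm lam * norm eta = lam \<bullet> eta" and lam: "lam \<noteq> 0" and s: "s < T"
  shows "sgn (costate T lam eta s) = lam /\<^sub>R norm lam"
proof -
  have l0: "norm lam > 0" using lam by simp
  have "norm lam *\<^sub>R eta = norm eta *\<^sub>R lam" using al by (simp flip: norm_cauchy_schwarz_eq)
  then have "inverse (norm lam) *\<^sub>R (norm lam *\<^sub>R eta) = inverse (norm lam) *\<^sub>R (norm eta *\<^sub>R lam)"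
    by (rule arg_cong)
  then have eta: "eta = (norm eta / norm lam) *\<^sub>R lam"
    using l0 by (simp add: divide_inverse mult.commute)
  have "costate T lam eta s = (1 - exp (s - T) + exp (s - T) * (norm eta / norm lam)) *\<^sub>R lam"
    unfolding costate_def by (subst eta) (simp add: algebra_simps)
  moreover have "1 - exp (s - T) + exp (s - T) * (norm eta / norm lam) > 0"
    using s by (intro add_pos_nonneg) auto
  ultimately show ?thesis by (simp add: sgn_scaleR sgn_div_norm)
qed

lemma sgn_costate_zero: "sgn (costate T 0 eta s) = eta /\<^sub>R norm eta"
  by (simp add: costate_def sgn_scaleR sgn_div_norm)

section \<open>The boundary of the reachable set\<close>

lemma impulse_eq_lebesgue_integral:
  assumes "u \<in> admissible_controls" "continuous_on {0..T} g"
  shows "impulse g u T = (\<integral>s. g s *\<^sub>R u s \<partial>lebesgue_on {0..T})"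
  unfolding impulse_def using lebesgue_integral_eq_integral[OF integrable_control[OF assms]] by simp

definition endpoint :: "real^'n \<Rightarrow> real \<Rightarrow> (real \<Rightarrow> real^'n) \<Rightarrow> (real^'n) \<times> (real^'n)" where
  "endpoint w T u = (position w u T, velocity w u T)"

definition payoff :: "real \<Rightarrow> (real^'n) \<times> (real^'n) \<Rightarrow> (real \<Rightarrow> real^'n) \<Rightarrow> real" where
  "payoff T p u = (\<integral>s. costate T (fst p) (snd p) s \<bullet> u s \<partial>lebesgue_on {0..T})"

text \<open>Written in the form \<open>1 u(s)\<close> and \<open>e\<^sup>s u(s)\<close> so that integration yields the two impulses.\<close>

lemma costate_inner:
  "costate T lam eta s \<bullet> x = lam \<bullet> (1 *\<^sub>R x) + exp (- T) * ((eta - lam) \<bullet> (exp s *\<^sub>R x))"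
  by (simp add: costate_def inner_add_left exp_diff exp_minus divide_inverse mult_ac)

lemma integrable_costate_inner:
  assumes u: "u \<in> admissible_controls"
  shows "integrable (lebesgue_on {0..T}) (\<lambda>s. costate T lam eta s \<bullet> u s)"
  unfolding costate_inner
  by (intro Bochner_Integration.integrable_add integrable_mult_right integrable_inner_right
      integrable_control[OF u] continuous_intros)

text \<open>The costate is exactly the density with which the control at time \<open>s\<close> moves the endpoint in the
direction \<open>p\<close>.\<close>

lemma inner_endpoint:
  assumes u: "u \<in> admissible_controls"
  shows "p \<bullet> endpoint w T u = fst p \<bullet> w + exp (- T) * ((snd p - fst p) \<bullet> w) + payoff T p u"
proof -
  have i1: "integrable (lebesgue_on {0..T}) (\<lambda>s. 1 *\<^sub>R u s)"
    and i2: "integrable (lebesgue_on {0..T}) (\<lambda>s. exp s *\<^sub>R u s)"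
    by (intro integrable_control[OF u] continuous_intros)+
  have "payoff T p u = fst p \<bullet> (\<integral>s. 1 *\<^sub>R u s \<partial>lebesgue_on {0..T})
      + exp (- T) * ((snd p - fst p) \<bullet> (\<integral>s. exp s *\<^sub>R u s \<partial>lebesgue_on {0..T}))"
    unfolding payoff_def costate_inner
    by (subst Bochner_Integration.integral_add)
       (use i1 i2 in \<open>simp_all only: integral_mult_right_zero integral_inner_right integrable_inner_right integrable_mult_right\<close>)
  also have "\<dots> = fst p \<bullet> impulse (\<lambda>_. 1) u T + exp (- T) * ((snd p - fst p) \<bullet> impulse exp u T)"
    by (subst (1 2) impulse_eq_lebesgue_integral[OF u]) (auto intro: continuous_intros)
  finally show ?thesis
    by (simp add: endpoint_def inner_prod_def position_def velocity_def inner_add_right inner_diff_left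
        inner_diff_right algebra_simps)
qed

lemma extremal_AE:
  assumes "extremal_control T p v"
  shows "AE s in lebesgue_on {0..T}. v s = sgn (costate T (fst p) (snd p) s)"
  using assms by (simp add: extremal_control_def sgn_div_norm)

text \<open>If \<open>\<eta>\<close> vanishes at two times, then \<open>\<xi>\<^sub>T = 0\<close>, hence \<open>\<eta>\<close> is the constant \<open>\<lambda>\<^sub>T = 0\<close> and \<open>p = 0\<close>.\<close>

lemma costate_nonzero_AE:
  assumes "p \<noteq> 0"
  shows "AE s in lebesgue_on {0..T}. costate T (fst p) (snd p) s \<noteq> 0"
proof -
  let ?Z = "{s. costate T (fst p) (snd p) s = 0}"
  have "s = t" if "s \<in> ?Z" "t \<in> ?Z" for s t
  proof (rule ccontr)
    assume "s \<noteq> t"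
    have "(exp (s - T) - exp (t - T)) *\<^sub>R (snd p - fst p)
        = costate T (fst p) (snd p) s - costate T (fst p) (snd p) t"
      by (simp add: costate_def scaleR_diff_left)
    also have "\<dots> = 0" using that by simp
    finally have "snd p = fst p" using \<open>s \<noteq> t\<close> by simp
    moreover from this have "fst p = 0" using that(1) by (simp add: costate_def split: if_splits)
    ultimately show False using assms by (simp add: prod_eq_iff)
  qed
  then obtain a where "?Z \<subseteq> {a}" by blast
  then have "negligible ?Z" using negligible_sing negligible_subset by blast
  then show ?thesis by (subst AE_lebesgue_on_iff_negligible) auto
qed

lemma inner_le_inner_sgn:
  fixes c x :: "'a::real_inner"
  assumes "norm x \<le> 1"
  shows "c \<bullet> x \<le> c \<bullet> sgn c"
proof -
  have "c \<bullet> x \<le> norm c * norm x" by (rule norm_cauchy_schwarz)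
  also have "\<dots> \<le> norm c" using assms by (simp add: mult_left_le)
  also have "\<dots> = c \<bullet> sgn c" 
    by (cases "c = 0") (simp_all add: sgn_div_norm dot_square_norm power2_eq_square)
  finally show ?thesis .
qed

lemma extremal_pointwise_max:
  assumes u: "u \<in> admissible_controls" and v: "extremal_control T p v"
  shows "AE s in lebesgue_on {0..T}.
    costate T (fst p) (snd p) s \<bullet> u s \<le> costate T (fst p) (snd p) s \<bullet> v s"
  using extremal_AE[OF v] AE_space
proof eventually_elim
  case (elim s)
  then have "norm (u s) \<le> 1" using admissible_norm_le[OF u] by simp
  then show ?case unfolding elim(1) by (rule inner_le_inner_sgn)
qed

lemma extremal_maximises:
  assumes u: "u \<in> admissible_controls" and v: "extremal_control T p v"
  shows "p \<bullet> endpoint w T u \<le> p \<bullet> endpoint w T v"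
proof -
  have va: "v \<in> admissible_controls" using v by (simp add: extremal_control_def)
  have "payoff T p u \<le> payoff T p v"
    unfolding payoff_def
    by (rule integral_mono_AE[OF integrable_costate_inner[OF u] integrable_costate_inner[OF va]
          extremal_pointwise_max[OF u v]])
  then show ?thesis using inner_endpoint[OF u] inner_endpoint[OF va] by simp
qed

text \<open>The unit ball is strictly convex: a vector whose inner product with \<open>c\<close> nearly attains the maximum is
near the maximiser. This estimate turns convergence of payoffs into convergence of controls.\<close>

lemma near_maximiser:
  fixes c x :: "'a::real_inner"
  assumes "norm x \<le> 1" "c \<noteq> 0"
  shows "(norm (x - sgn c))\<^sup>2 \<le> 2 / norm c * (c \<bullet> sgn c - c \<bullet> x)"
proof -
  have c: "c = norm c *\<^sub>R sgn c" using assms(2) by (simp add: sgn_div_norm)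
  have n: "sgn c \<bullet> sgn c = 1"
    using assms(2) by (simp add: norm_sgn flip: power2_norm_eq_inner)
  have "(norm (x - sgn c))\<^sup>2 = x \<bullet> x + 1 - 2 * (sgn c \<bullet> x)"
    unfolding power2_norm_eq_inner using n by (simp add: inner_diff inner_commute)
  also have "x \<bullet> x \<le> 1" using assms(1) by (simp add: norm_le_square)
  also have "1 + 1 - 2 * (sgn c \<bullet> x) = 2 * (1 - sgn c \<bullet> x)" by simp
  also have "\<dots> = 2 / norm c * (norm c * (sgn c \<bullet> sgn c) - norm c * (sgn c \<bullet> x))"
    using assms(2) n by (simp add: field_simps)
  also have "\<dots> = 2 / norm c * (c \<bullet> sgn c - c \<bullet> x)"
    by (metis c inner_scaleR_left)
  finally show ?thesis by simp
qed

lemma impulse_dominated_convergence: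
  assumes u: "\<And>n. u n \<in> admissible_controls" and v: "v \<in> admissible_controls"
    and g: "continuous_on {0..T} g"
    and lim: "AE s in lebesgue_on {0..T}. (\<lambda>n. u n s) \<longlonglongrightarrow> v s"
  shows "(\<lambda>n. impulse g (u n) T) \<longlonglongrightarrow> impulse g v T"
  unfolding impulse_eq_lebesgue_integral[OF u g] impulse_eq_lebesgue_integral[OF v g]
proof (rule integral_dominated_convergence[where w = "\<lambda>s. \<bar>g s\<bar>"])
  show "integrable (lebesgue_on {0..T}) (\<lambda>s. \<bar>g s\<bar>)"
    by (rule continuous_imp_integrable_real) (intro continuous_intros g)
  show "AE s in lebesgue_on {0..T}. (\<lambda>n. g s *\<^sub>R u n s) \<longlonglongrightarrow> g s *\<^sub>R v s"
    using lim by eventually_elim (intro tendsto_intros)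
  show "AE s in lebesgue_on {0..T}. norm (g s *\<^sub>R u n s) \<le> \<bar>g s\<bar>" for n
    using AE_space
  proof eventually_elim
    case (elim s)
    then have "norm (u n s) \<le> 1" using admissible_norm_le[OF u] by simp
    then show ?case by (simp add: mult_left_le)
  qed
qed (use integrable_control[OF u g] integrable_control[OF v g] in auto)

text \<open>The payoff deficit of \<open>u\<^sub>n\<close> is the \<open>L\<^sup>1\<close> norm of its pointwise deficit, because the latter is
nonnegative. An \<open>L\<^sup>1\<close> null sequence has a subsequence that tends to \<open>0\<close> almost everywhere, and
\<open>near_maximiser\<close> then gives convergence of the controls.\<close>

lemma maximising_sequence_converges:
  assumes p: "p \<noteq> 0" and v: "extremal_control T p v" and u: "\<And>n. u n \<in> admissible_controls"
    and lim: "(\<lambda>n. p \<bullet> endpoint w T (u n)) \<longlonglongrightarrow> p \<bullet> endpoint w T v"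
  obtains r where "strict_mono r" "(\<lambda>n. endpoint w T (u (r n))) \<longlonglongrightarrow> endpoint w T v"
proof -
  let ?M = "lebesgue_on {0..T}"
  let ?c = "costate T (fst p) (snd p)"
  have va: "v \<in> admissible_controls" using v by (simp add: extremal_control_def)
  define gap where "gap n s = ?c s \<bullet> v s - ?c s \<bullet> u n s" for n s
  have int: "integrable ?M (gap n)" for n
    unfolding gap_def by (intro Bochner_Integration.integrable_diff integrable_costate_inner u va)
  have "(\<integral>s. norm (gap n s) \<partial>?M) = p \<bullet> endpoint w T v - p \<bullet> endpoint w T (u n)" for n
  proof -
    have "AE s in ?M. norm (gap n s) = gap n s"
      using extremal_pointwise_max[OF u[of n] v] by eventually_elim (simp add: gap_def)
    then have "(\<integral>s. norm (gap n s) \<partial>?M) = (\<integral>s. gap n s \<partial>?M)"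
      using int by (intro integral_cong_AE) auto
    also have "\<dots> = payoff T p v - payoff T p (u n)"
      unfolding gap_def payoff_def
      by (intro Bochner_Integration.integral_diff integrable_costate_inner u va)
    finally show ?thesis using inner_endpoint[OF u] inner_endpoint[OF va] by simp
  qed
  moreover have "(\<lambda>n. p \<bullet> endpoint w T v - p \<bullet> endpoint w T (u n)) \<longlonglongrightarrow> 0"
    using tendsto_diff[OF tendsto_const[of "p \<bullet> endpoint w T v"] lim] by simp
  ultimately obtain r where r: "strict_mono r" "AE s in ?M. (\<lambda>n. gap (r n) s) \<longlonglongrightarrow> 0"
    using tendsto_L1_AE_subseq[of ?M gap] int by auto
  have "AE s in ?M. (\<lambda>n. u (r n) s) \<longlonglongrightarrow> v s"
    using r(2) extremal_AE[OF v] costate_nonzero_AE[OF p] AE_space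
  proof eventually_elim
    case (elim s)
    have le: "(norm (u (r n) s - v s))\<^sup>2 \<le> 2 / norm (?c s) * gap (r n) s" for n
      using near_maximiser[of "u (r n) s" "?c s"] admissible_norm_le[OF u] elim
      by (simp add: gap_def)
    have "(\<lambda>n. 2 / norm (?c s) * gap (r n) s) \<longlonglongrightarrow> 0"
      by (rule tendsto_mult_right_zero[OF elim(1)])
    then have "(\<lambda>n. (norm (u (r n) s - v s))\<^sup>2) \<longlonglongrightarrow> 0"
      by (rule Lim_null_comparison[rotated]) (use le in simp)
    from tendsto_real_sqrt[OF this] have "(\<lambda>n. norm (u (r n) s - v s)) \<longlonglongrightarrow> 0"
      by simp
    then show ?case by (rule LIM_zero_cancel[OF tendsto_norm_zero_cancel])
  qed
  note conv = impulse_dominated_convergence[of "\<lambda>n. u (r n)", OF u va _ this]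
  have "(\<lambda>n. impulse exp (u (r n)) T) \<longlonglongrightarrow> impulse exp v T"
    "(\<lambda>n. impulse (\<lambda>_. 1) (u (r n)) T) \<longlonglongrightarrow> impulse (\<lambda>_. 1) v T"
    by (intro conv continuous_intros)+
  then have "(\<lambda>n. endpoint w T (u (r n))) \<longlonglongrightarrow> endpoint w T v"
    unfolding endpoint_def position_def velocity_def
    by (intro tendsto_Pair tendsto_add tendsto_diff tendsto_scaleR tendsto_const)
  with r(1) show thesis by (rule that)
qed

lemma reachable_set_eq_endpoints:
  assumes "T \<ge> 0"
  shows "reachable_set k v0 T = endpoint (axis k v0) T ` admissible_controls"
proof -
  have "(rocket_pos k v0 u T, rocket_vel k v0 u T) = endpoint (axis k v0) T u"
    if "u \<in> admissible_controls" for u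
    by (simp add: endpoint_def rocket_pos_eq[OF that assms] rocket_vel_eq[OF that assms])
  then show ?thesis unfolding reachable_set_def Setcompr_eq_image by (rule image_cong[OF refl])
qed

lemma impulse_affine:
  assumes u: "u \<in> admissible_controls" and v: "v \<in> admissible_controls" and g: "continuous_on {0..T} g"
  shows "impulse g (\<lambda>s. a *\<^sub>R u s + b *\<^sub>R v s) T = a *\<^sub>R impulse g u T + b *\<^sub>R impulse g v T"
proof -
  have "impulse g (\<lambda>s. a *\<^sub>R u s + b *\<^sub>R v s) T
      = integral {0..T} (\<lambda>s. a *\<^sub>R (g s *\<^sub>R u s) + b *\<^sub>R (g s *\<^sub>R v s))"
    by (simp add: impulse_def scaleR_add_right mult.commute)
  also have "\<dots> = a *\<^sub>R impulse g u T + b *\<^sub>R impulse g v T"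
    unfolding impulse_def
    by (subst Henstock_Kurzweil_Integration.integral_add[OF integrable_cmul[OF integrable_on_control[OF u g]]
          integrable_cmul[OF integrable_on_control[OF v g]]])
       (simp only: Henstock_Kurzweil_Integration.integral_cmul)
  finally show ?thesis .
qed

lemma convex_reachable_set:
  assumes T: "T \<ge> 0"
  shows "convex (reachable_set k v0 T)"
  unfolding reachable_set_eq_endpoints[OF T]
proof (rule convexI)
  let ?w = "axis k v0"
  fix x y and a b :: real
  assume x: "x \<in> endpoint ?w T ` admissible_controls" and y: "y \<in> endpoint ?w T ` admissible_controls"
    and ab: "0 \<le> a" "0 \<le> b" "a + b = 1"
  then obtain u v where uv: "u \<in> admissible_controls" "v \<in> admissible_controls"
    "x = endpoint ?w T u" "y = endpoint ?w T v" by blast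
  let ?c = "\<lambda>s. a *\<^sub>R u s + b *\<^sub>R v s"
  have "norm (?c t) \<le> 1" if t: "t \<ge> 0" for t
  proof -
    have "norm (?c t) \<le> a * norm (u t) + b * norm (v t)"
      by (rule order_trans[OF norm_triangle_ineq]) (use ab in simp)
    also have "\<dots> \<le> a * 1 + b * 1"
      using ab uv t by (intro add_mono mult_left_mono admissible_norm_le)
    finally show ?thesis using ab by simp
  qed
  then have c: "?c \<in> admissible_controls"
    using uv(1,2) by (auto simp: admissible_controls_def)
  have "endpoint ?w T ?c = a *\<^sub>R x + b *\<^sub>R y"
  proof -
    have 1: "impulse exp ?c T = a *\<^sub>R impulse exp u T + b *\<^sub>R impulse exp v T"
      "impulse (\<lambda>_. 1) ?c T = a *\<^sub>R impulse (\<lambda>_. 1) u T + b *\<^sub>R impulse (\<lambda>_. 1) v T"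
      by (intro impulse_affine uv continuous_intros)+
    have 2: "?w = a *\<^sub>R ?w + b *\<^sub>R ?w" using ab by (simp flip: scaleR_add_left)
    have vel: "velocity ?w ?c T = a *\<^sub>R velocity ?w u T + b *\<^sub>R velocity ?w v T"
      unfolding velocity_def 1 by (subst 2) (simp add: algebra_simps)
    have "position ?w ?c T = a *\<^sub>R position ?w u T + b *\<^sub>R position ?w v T"
      unfolding position_def vel 1 by (subst 2) (simp add: algebra_simps)
    with vel show ?thesis by (simp add: endpoint_def uv)
  qed
  then show "a *\<^sub>R x + b *\<^sub>R y \<in> endpoint ?w T ` admissible_controls" using c by force
qed

text \<open>Covers sets with empty interior as well, where a hyperplane containing the set serves; for \<open>T = 0\<close>
the reachable set is a single point, so this case does occur.\<close>

lemma convex_frontier_supporting_hyperplane: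
  fixes S :: "'a::euclidean_space set"
  assumes S: "convex S" and z: "z \<in> frontier S"
  obtains a where "norm a = 1" "\<And>y. y \<in> S \<Longrightarrow> a \<bullet> y \<le> a \<bullet> z"
proof -
  have "\<exists>a. a \<noteq> 0 \<and> (\<forall>y\<in>S. a \<bullet> y \<le> a \<bullet> z)"
  proof (cases "interior S = {}")
    case True
    then obtain a b where ab: "a \<noteq> 0" "S \<subseteq> {x. a \<bullet> x = b}"
      using empty_interior_subset_hyperplane[OF S] by blast
    then have "closure S \<subseteq> {x. a \<bullet> x = b}" by (simp add: closure_minimal closed_hyperplane)
    then have "a \<bullet> z = b" using z by (auto simp: frontier_def)
    then show ?thesis using ab by (intro exI[of _ a]) auto
  next
    case False
    have "z \<in> closure S" "z \<notin> rel_interior S"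
      using z False by (auto simp: frontier_def rel_interior_nonempty_interior)
    then obtain a where "a \<noteq> 0" "\<And>y. y \<in> closure S \<Longrightarrow> a \<bullet> z \<le> a \<bullet> y"
      using supporting_hyperplane_relative_frontier[OF S] by blast
    then show ?thesis using closure_subset by (intro exI[of _ "- a"]) auto
  qed
  then obtain a where a: "a \<noteq> 0" "\<And>y. y \<in> S \<Longrightarrow> a \<bullet> y \<le> a \<bullet> z" by blast
  show thesis
  proof
    show "norm (sgn a) = 1" using a by (simp add: norm_sgn)
    show "sgn a \<bullet> y \<le> sgn a \<bullet> z" if "y \<in> S" for y
      using a that by (simp add: sgn_div_norm mult_left_mono)
  qed
qed

lemma frontier_reachable_set:
  assumes T: "T \<ge> 0" and v: "\<And>p. p \<noteq> 0 \<Longrightarrow> extremal_control T p (v p)"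
  shows "frontier (reachable_set k v0 T) = {endpoint (axis k v0) T (v p) | p. norm p = 1}"
proof -
  let ?w = "axis k v0" and ?R = "reachable_set k v0 T"
  have R: "?R = endpoint ?w T ` admissible_controls" by (rule reachable_set_eq_endpoints[OF T])
  have ext: "extremal_control T p (v p)" "p \<noteq> 0" "v p \<in> admissible_controls" if "norm p = 1" for p
  proof -
    show "p \<noteq> 0" using that by auto
    then show "extremal_control T p (v p)" by (rule v)
    then show "v p \<in> admissible_controls" by (simp add: extremal_control_def)
  qed
  show ?thesis
  proof (intro equalityI subsetI)
    fix z assume z: "z \<in> frontier ?R"
    obtain p where p: "norm p = 1" "\<And>y. y \<in> ?R \<Longrightarrow> p \<bullet> y \<le> p \<bullet> z"
      using convex_frontier_supporting_hyperplane[OF convex_reachable_set[OF T] z] by blast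
    have "z \<in> closure ?R" using z by (simp add: frontier_def)
    then obtain x where x: "\<And>n. x n \<in> ?R" "x \<longlonglongrightarrow> z"
      unfolding closure_sequential by blast
    have "\<exists>u. \<forall>n. u n \<in> admissible_controls \<and> x n = endpoint ?w T (u n)"
      by (rule choice) (use x(1) R in blast)
    then obtain u where u: "\<And>n. u n \<in> admissible_controls" "\<And>n. x n = endpoint ?w T (u n)" by blast
    have lim: "(\<lambda>n. p \<bullet> endpoint ?w T (u n)) \<longlonglongrightarrow> p \<bullet> z"
      using tendsto_inner[OF tendsto_const x(2)] u(2) by simp
    have "p \<bullet> z \<le> p \<bullet> endpoint ?w T (v p)"
      by (rule LIMSEQ_le_const2[OF lim]) (use extremal_maximises[OF u(1) ext(1)[OF p(1)]] in blast)
    moreover have "p \<bullet> endpoint ?w T (v p) \<le> p \<bullet> z"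
      by (rule p(2)) (use R ext(3)[OF p(1)] in blast)
    ultimately have "(\<lambda>n. p \<bullet> endpoint ?w T (u n)) \<longlonglongrightarrow> p \<bullet> endpoint ?w T (v p)"
      using lim by simp
    then obtain r where r: "strict_mono r" "(\<lambda>n. endpoint ?w T (u (r n))) \<longlonglongrightarrow> endpoint ?w T (v p)"
      using maximising_sequence_converges[where u = u, OF ext(2)[OF p(1)] ext(1)[OF p(1)] u(1)] by blast
    have "(\<lambda>n. endpoint ?w T (u (r n))) \<longlonglongrightarrow> z"
      using LIMSEQ_subseq_LIMSEQ[OF x(2) r(1)] u(2) by (simp add: o_def)
    then have "z = endpoint ?w T (v p)" using r(2) by (rule LIMSEQ_unique)
    then show "z \<in> {endpoint ?w T (v p) | p. norm p = 1}" using p(1) by blast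
  next
    fix z assume "z \<in> {endpoint ?w T (v p) | p. norm p = 1}"
    then obtain p where p: "norm p = 1" and z: "z = endpoint ?w T (v p)" by blast
    have zR: "z \<in> ?R" using z R ext(3)[OF p] by blast
    have "z \<notin> interior ?R"
    proof
      assume "z \<in> interior ?R"
      then obtain e where e: "e > 0" "cball z e \<subseteq> ?R" by (auto simp: mem_interior_cball)
      have "z + e *\<^sub>R p \<in> ?R" using e p by (intro subsetD[OF e(2)]) (simp add: dist_norm)
      then obtain u where u: "u \<in> admissible_controls" "z + e *\<^sub>R p = endpoint ?w T u" using R by blast
      have "p \<bullet> (z + e *\<^sub>R p) \<le> p \<bullet> z"
        using extremal_maximises[OF u(1) ext(1)[OF p], of ?w] u(2) z by simp
      moreover have "p \<bullet> p = 1" using p by (simp flip: power2_norm_eq_inner)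
      ultimately show False using e(1) by (simp add: inner_add_right)
    qed
    then show "z \<in> frontier ?R" using zR closure_subset by (auto simp: frontier_def)
  qed
qed

section \<open>Extremal trajectories and the reachable boundary\<close>

theorem mainTheorem1:
  fixes v0 :: real and k :: "'n::finite"
    and u\<^sub>E :: "real \<Rightarrow> (real^'n) \<times> (real^'n) \<Rightarrow> real \<Rightarrow> real^'n"
  assumes v0: "0 \<le> v0" "v0 < 1"
    and u\<^sub>E: "\<And>T p. T \<ge> 0 \<Longrightarrow> p \<noteq> 0 \<Longrightarrow> extremal_control T p (u\<^sub>E T p)"
  shows "(\<forall>T\<ge>0. \<forall>lam\<^sub>T eta\<^sub>T. (lam\<^sub>T, eta\<^sub>T) \<noteq> 0 \<longrightarrow>
      (let xi\<^sub>T = eta\<^sub>T - lam\<^sub>T;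
           eta = costate T lam\<^sub>T eta\<^sub>T;
           r\<^sub>E = rocket_pos k v0 (u\<^sub>E T (lam\<^sub>T, eta\<^sub>T));
           v\<^sub>E = rocket_vel k v0 (u\<^sub>E T (lam\<^sub>T, eta\<^sub>T));
           \<theta> = T + ln (norm lam\<^sub>T / (norm lam\<^sub>T + norm eta\<^sub>T));
           L = (\<lambda>t. ln ((norm xi\<^sub>T * norm (eta t) + xi\<^sub>T \<bullet> eta t) /
                        (norm xi\<^sub>T * norm (eta 0) + xi\<^sub>T \<bullet> eta 0)))
       in \<forall>t\<in>{0..T}.
         (norm lam\<^sub>T * norm eta\<^sub>T > \<bar>lam\<^sub>T \<bullet> eta\<^sub>T\<bar> \<longrightarrow>
            v\<^sub>E t = exp (- t) *\<^sub>R axis k v0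
              + ((norm (eta t) - norm (eta 0)) / (norm xi\<^sub>T)\<^sup>2 * exp (T - t)) *\<^sub>R xi\<^sub>T
              + (exp (T - t) * L t) *\<^sub>R
                  ((1 / norm xi\<^sub>T) *\<^sub>R lam\<^sub>T - ((lam\<^sub>T \<bullet> xi\<^sub>T) / norm xi\<^sub>T ^ 3) *\<^sub>R xi\<^sub>T) \<and>
            r\<^sub>E t = axis k v0 - v\<^sub>E t
              + (t + ln ((norm lam\<^sub>T * norm (eta 0) + lam\<^sub>T \<bullet> eta 0) /
                         (norm lam\<^sub>T * norm (eta t) + lam\<^sub>T \<bullet> eta t))) *\<^sub>R (lam\<^sub>T /\<^sub>R norm lam\<^sub>T)
              + L t *\<^sub>R (xi\<^sub>T /\<^sub>R norm xi\<^sub>T)) \<and>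
         (norm lam\<^sub>T * norm eta\<^sub>T = - (lam\<^sub>T \<bullet> eta\<^sub>T) \<and> lam\<^sub>T \<noteq> 0 \<longrightarrow>
            v\<^sub>E t = exp (- t) *\<^sub>R axis k v0
              + (\<bar>exp (- t) - exp (\<theta> - t)\<bar> - \<bar>1 - exp (\<theta> - t)\<bar>) *\<^sub>R (lam\<^sub>T /\<^sub>R norm lam\<^sub>T) \<and>
            r\<^sub>E t = axis k v0 - v\<^sub>E t + (\<bar>\<theta>\<bar> - \<bar>t - \<theta>\<bar>) *\<^sub>R (lam\<^sub>T /\<^sub>R norm lam\<^sub>T)) \<and>
         (norm lam\<^sub>T * norm eta\<^sub>T = lam\<^sub>T \<bullet> eta\<^sub>T \<and> lam\<^sub>T \<noteq> 0 \<longrightarrow>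
            v\<^sub>E t = exp (- t) *\<^sub>R axis k v0 + (1 - exp (- t)) *\<^sub>R (lam\<^sub>T /\<^sub>R norm lam\<^sub>T) \<and>
            r\<^sub>E t = axis k v0 - v\<^sub>E t + t *\<^sub>R (lam\<^sub>T /\<^sub>R norm lam\<^sub>T)) \<and>
         (lam\<^sub>T = 0 \<longrightarrow>
            v\<^sub>E t = exp (- t) *\<^sub>R axis k v0 + (1 - exp (- t)) *\<^sub>R (eta\<^sub>T /\<^sub>R norm eta\<^sub>T) \<and>
            r\<^sub>E t = axis k v0 - v\<^sub>E t + t *\<^sub>R (eta\<^sub>T /\<^sub>R norm eta\<^sub>T)))) \<and>
    (\<forall>T\<ge>0. frontier (reachable_set k v0 T) =
      {(rocket_pos k v0 (u\<^sub>E T p) T, rocket_vel k v0 (u\<^sub>E T p) T) | p. norm p = 1})"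
proof (intro conjI allI impI)
  fix T :: real and lam eta :: "real^'n"
  assume T: "T \<ge> 0" and nz: "(lam, eta) \<noteq> 0"
  let ?w = "axis k v0 :: real^'n"
  define u where "u = u\<^sub>E T (lam, eta)"
  have ex: "extremal_control T (lam, eta) u" unfolding u_def by (rule u\<^sub>E[OF T nz])
  then have adm: "u \<in> admissible_controls" by (simp add: extremal_control_def)
  have vel: "rocket_vel k v0 u t = exp (- t) *\<^sub>R ?w + exp (- t) *\<^sub>R impulse exp u t" if "0 \<le> t" for t
    by (simp add: rocket_vel_eq[OF adm that] velocity_def scaleR_add_right)
  have pos: "rocket_pos k v0 u t = ?w - rocket_vel k v0 u t + impulse (\<lambda>_. 1) u t" if "0 \<le> t" for t
    by (simp add: rocket_pos_eq[OF adm that] rocket_vel_eq[OF adm that] position_def)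
  have decay: "exp (- t) * (exp t - 1) = 1 - exp (- t)" for t :: real
    by (simp add: right_diff_distrib flip: exp_add)
  have const: "rocket_vel k v0 u t = exp (- t) *\<^sub>R ?w + (1 - exp (- t)) *\<^sub>R w \<and>
      rocket_pos k v0 u t = ?w - rocket_vel k v0 u t + t *\<^sub>R w"
    if t: "0 \<le> t" "t \<le> T" and w: "\<And>s. s < T \<Longrightarrow> sgn (costate T lam eta s) = w" for t w
  proof -
    note imp = extremal_impulse_const[OF ex t, of w, unfolded fst_conv snd_conv, OF w]
    show ?thesis by (simp add: vel[OF t(1)] pos[OF t(1)] imp decay)
  qed
  show "let xi\<^sub>T = eta - lam;
           c = costate T lam eta;
           r\<^sub>E = rocket_pos k v0 (u\<^sub>E T (lam, eta));
           v\<^sub>E = rocket_vel k v0 (u\<^sub>E T (lam, eta));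
           \<theta> = T + ln (norm lam / (norm lam + norm eta));
           L = (\<lambda>t. ln ((norm xi\<^sub>T * norm (c t) + xi\<^sub>T \<bullet> c t) /
                        (norm xi\<^sub>T * norm (c 0) + xi\<^sub>T \<bullet> c 0)))
       in \<forall>t\<in>{0..T}.
         (norm lam * norm eta > \<bar>lam \<bullet> eta\<bar> \<longrightarrow>
            v\<^sub>E t = exp (- t) *\<^sub>R axis k v0
              + ((norm (c t) - norm (c 0)) / (norm xi\<^sub>T)\<^sup>2 * exp (T - t)) *\<^sub>R xi\<^sub>T
              + (exp (T - t) * L t) *\<^sub>R
                  ((1 / norm xi\<^sub>T) *\<^sub>R lam - ((lam \<bullet> xi\<^sub>T) / norm xi\<^sub>T ^ 3) *\<^sub>R xi\<^sub>T) \<and>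
            r\<^sub>E t = axis k v0 - v\<^sub>E t
              + (t + ln ((norm lam * norm (c 0) + lam \<bullet> c 0) /
                         (norm lam * norm (c t) + lam \<bullet> c t))) *\<^sub>R (lam /\<^sub>R norm lam)
              + L t *\<^sub>R (xi\<^sub>T /\<^sub>R norm xi\<^sub>T)) \<and>
         (norm lam * norm eta = - (lam \<bullet> eta) \<and> lam \<noteq> 0 \<longrightarrow>
            v\<^sub>E t = exp (- t) *\<^sub>R axis k v0
              + (\<bar>exp (- t) - exp (\<theta> - t)\<bar> - \<bar>1 - exp (\<theta> - t)\<bar>) *\<^sub>R (lam /\<^sub>R norm lam) \<and>
            r\<^sub>E t = axis k v0 - v\<^sub>E t + (\<bar>\<theta>\<bar> - \<bar>t - \<theta>\<bar>) *\<^sub>R (lam /\<^sub>R norm lam)) \<and>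
         (norm lam * norm eta = lam \<bullet> eta \<and> lam \<noteq> 0 \<longrightarrow>
            v\<^sub>E t = exp (- t) *\<^sub>R axis k v0 + (1 - exp (- t)) *\<^sub>R (lam /\<^sub>R norm lam) \<and>
            r\<^sub>E t = axis k v0 - v\<^sub>E t + t *\<^sub>R (lam /\<^sub>R norm lam)) \<and>
         (lam = 0 \<longrightarrow>
            v\<^sub>E t = exp (- t) *\<^sub>R axis k v0 + (1 - exp (- t)) *\<^sub>R (eta /\<^sub>R norm eta) \<and>
            r\<^sub>E t = axis k v0 - v\<^sub>E t + t *\<^sub>R (eta /\<^sub>R norm eta))"
    unfolding Let_def u_def[symmetric]
  proof (intro ballI conjI impI; (elim conjE)?)
    fix t assume "t \<in> {0..T}"
    then have t: "0 \<le> t" "t \<le> T" by auto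
    let ?xi = "eta - lam" and ?c = "costate T lam eta"
    {
      assume indep: "norm lam * norm eta > \<bar>lam \<bullet> eta\<bar>"
      have e: "exp (- t) * (exp T * a) = exp (T - t) * a" for a :: real
        by (simp add: exp_diff exp_minus divide_inverse)
      have e': "exp (- t) * (exp T * a / b) = a / b * exp (T - t)" for a b :: real
        using e[of "a / b"] by (simp add: mult.commute)
      note imp = extremal_impulse_generic[OF ex t indep]
      show "rocket_vel k v0 u t = exp (- t) *\<^sub>R axis k v0
              + ((norm (?c t) - norm (?c 0)) / (norm ?xi)\<^sup>2 * exp (T - t)) *\<^sub>R ?xi
              + (exp (T - t) * ln ((norm ?xi * norm (?c t) + ?xi \<bullet> ?c t) /
                        (norm ?xi * norm (?c 0) + ?xi \<bullet> ?c 0))) *\<^sub>R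
                  ((1 / norm ?xi) *\<^sub>R lam - ((lam \<bullet> ?xi) / norm ?xi ^ 3) *\<^sub>R ?xi)"
        unfolding vel[OF t(1)] imp(1) scaleR_add_right scaleR_scaleR e e' by (simp only: add.assoc)
      show "rocket_pos k v0 u t = axis k v0 - rocket_vel k v0 u t
              + (t + ln ((norm lam * norm (?c 0) + lam \<bullet> ?c 0) /
                         (norm lam * norm (?c t) + lam \<bullet> ?c t))) *\<^sub>R (lam /\<^sub>R norm lam)
              + ln ((norm ?xi * norm (?c t) + ?xi \<bullet> ?c t) /
                        (norm ?xi * norm (?c 0) + ?xi \<bullet> ?c 0)) *\<^sub>R (?xi /\<^sub>R norm ?xi)"
        unfolding pos[OF t(1)] imp(2) by (simp only: add.assoc)
    next
      assume opp: "norm lam * norm eta = - (lam \<bullet> eta)" and lam: "lam \<noteq> 0"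
      define \<theta> where "\<theta> = T + ln (norm lam / (norm lam + norm eta))"
      note imp = extremal_impulse_opposite[OF ex t opp lam, folded \<theta>_def]
      have "exp (- t) * (\<bar>1 - exp \<theta>\<bar> - \<bar>exp t - exp \<theta>\<bar>) = \<bar>exp (- t) * (1 - exp \<theta>)\<bar> - \<bar>exp (- t) * (exp t - exp \<theta>)\<bar>"
        by (simp only: abs_mult abs_exp_cancel right_diff_distrib[of "exp (- t)" "\<bar>1 - exp \<theta>\<bar>"])
      also have "\<dots> = \<bar>exp (- t) - exp (\<theta> - t)\<bar> - \<bar>1 - exp (\<theta> - t)\<bar>"
        by (simp add: right_diff_distrib exp_diff exp_minus divide_inverse mult.commute)
      finally have e: "exp (- t) * (\<bar>1 - exp \<theta>\<bar> - \<bar>exp t - exp \<theta>\<bar>)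
          = \<bar>exp (- t) - exp (\<theta> - t)\<bar> - \<bar>1 - exp (\<theta> - t)\<bar>" .
      show "rocket_vel k v0 u t = exp (- t) *\<^sub>R axis k v0
              + (\<bar>exp (- t) - exp (T + ln (norm lam / (norm lam + norm eta)) - t)\<bar>
                 - \<bar>1 - exp (T + ln (norm lam / (norm lam + norm eta)) - t)\<bar>) *\<^sub>R (lam /\<^sub>R norm lam)"
        unfolding vel[OF t(1)] imp(1) \<theta>_def[symmetric] scaleR_scaleR[of "exp (- t)"] e by (rule refl)
      show "rocket_pos k v0 u t = axis k v0 - rocket_vel k v0 u t
              + (\<bar>T + ln (norm lam / (norm lam + norm eta))\<bar>
                 - \<bar>t - (T + ln (norm lam / (norm lam + norm eta)))\<bar>) *\<^sub>R (lam /\<^sub>R norm lam)"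
        unfolding pos[OF t(1)] imp(2) \<theta>_def[symmetric] by (rule refl)
    next
      assume "norm lam * norm eta = lam \<bullet> eta" "lam \<noteq> 0"
      note const[OF t sgn_costate_aligned[OF this]]
      then show "rocket_vel k v0 u t = exp (- t) *\<^sub>R axis k v0 + (1 - exp (- t)) *\<^sub>R (lam /\<^sub>R norm lam)"
        "rocket_pos k v0 u t = axis k v0 - rocket_vel k v0 u t + t *\<^sub>R (lam /\<^sub>R norm lam)"
        by blast+
    next
      assume "lam = 0"
      with const[OF t] show "rocket_vel k v0 u t = exp (- t) *\<^sub>R axis k v0 + (1 - exp (- t)) *\<^sub>R (eta /\<^sub>R norm eta)"
        "rocket_pos k v0 u t = axis k v0 - rocket_vel k v0 u t + t *\<^sub>R (eta /\<^sub>R norm eta)"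
        using sgn_costate_zero by blast+
    }
  qed
next
  fix T :: real assume T: "T \<ge> 0"
  have "(rocket_pos k v0 (u\<^sub>E T p) T, rocket_vel k v0 (u\<^sub>E T p) T) = endpoint (axis k v0) T (u\<^sub>E T p)"
    if "norm p = 1" for p
  proof -
    have "p \<noteq> 0" using that by auto
    then have "u\<^sub>E T p \<in> admissible_controls" using u\<^sub>E[OF T, of p] by (simp add: extremal_control_def)
    then show ?thesis using T by (simp add: endpoint_def rocket_pos_eq rocket_vel_eq)
  qed
  then have "z = (rocket_pos k v0 (u\<^sub>E T p) T, rocket_vel k v0 (u\<^sub>E T p) T) \<and> norm p = 1
      \<longleftrightarrow> z = endpoint (axis k v0) T (u\<^sub>E T p) \<and> norm p = 1" for z p
    by (cases "norm p = 1") simp_all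
  then show "frontier (reachable_set k v0 T) =
      {(rocket_pos k v0 (u\<^sub>E T p) T, rocket_vel k v0 (u\<^sub>E T p) T) | p. norm p = 1}"
    using frontier_reachable_set[of T "u\<^sub>E T" k v0, OF T] u\<^sub>E[OF T]
    by simp
qed

end
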